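(* Let $\mathbb{F}$ be a finite field. For every $k,m,r\in\mathbb{N}$ there exists $n\in\mathbb{N}$ such that for every $c:M^k_{n,k}(\mathbb{F})\to r$ there is $R\in\mathcal{E}_{n,m}(\mathbb{F})$ such that $\tau$ is a factor of $c$ on $R\cdot M^k_{m,k}(\mathbb{F})$, i.e. there is $\widehat{c}:\mathrm{GL}(\mathbb{F}^k)\to r$ with $c(R\cdot A)=\widehat{c}(\tau(R\cdot A))$ for every $A\in M^k_{m,k}(\mathbb{F})$.
   Context: $r$ is identified with $\{0,\dots,r-1\}$. $M^k_{n,m}(\mathbb{F})$ is the set of $n\times m$ matrices over $\mathbb{F}$ of rank $k$. $(u_i)$ denotes the unit vector basis. A $p\times q$ matrix $A$ is in reduced row echelon form (RREF) if there are $p_0\le p$ and a strictly increasing sequence $j_0<\dots<j_{p_0-1}<q$ such that $A u_{j_i}=u_i$ and $\langle A u_j\rangle_{j<j_i}=\langle u_l\rangle_{l<i}$ for every $i<p_0$; $A$ is in reduced column echelon form (RCEF) if its transpose is in RREF. $\mathcal{E}_{n,m}(\mathbb{F})$ is the set of $n\times m$ matrices of rank $m$ in RCEF. $\tau:M^k_{n,k}(\mathbb{F})\to\mathrm{GL}(\mathbb{F}^k)$ assigns to $A$ the unique invertible $k\times k$ matrix $\tau(A)$ such that $A\cdot\tau(A)$ is in RCEF. *)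

theory Defs
  imports "Jordan_Normal_Form.DL_Rank" "Jordan_Normal_Form.Gauss_Jordan_Elimination"
begin

definition mat_rank :: "'a::field mat \<Rightarrow> nat" where
  "mat_rank A = vec_space.rank (dim_row A) A"

definition rank_mats :: "nat \<Rightarrow> nat \<Rightarrow> nat \<Rightarrow> 'a::field mat set" where
  "rank_mats k n m = {A \<in> carrier_mat n m. mat_rank A = k}"

text \<open>Reduced column echelon form: the transpose is in reduced row echelon form.\<close>
definition col_echelon_form :: "'a::field mat \<Rightarrow> bool" where
  "col_echelon_form A \<longleftrightarrow> row_echelon_form (transpose_mat A)"

definition echelon_mats :: "nat \<Rightarrow> nat \<Rightarrow> 'a::field mat set" where
  "echelon_mats n m = {R \<in> rank_mats m n m. col_echelon_form R}"

definition GL_mats :: "nat \<Rightarrow> 'a::field mat set" where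
  "GL_mats k = {T \<in> carrier_mat k k. invertible_mat T}"

definition tau :: "nat \<Rightarrow> 'a::field mat \<Rightarrow> 'a mat" where
  "tau k A = (THE T. T \<in> GL_mats k \<and> col_echelon_form (A * T))"

end

(*
  Write A in M^k_{m,k} as an echelon matrix E = A * tau A times an invertible matrix. Colouring E by
  the function T |-> c (E * T) on the finite set GL(F^k) reduces the claim to a
  Graham-Leeb-Rothschild statement: some R in E_{n,m} has all R * E of the same colour.

  Number the vectors of F^k by 0, ..., q^k - 1 through base-q digits. The rows of an echelon matrix
  then form a word in which every new power q^j is preceded by smaller numbers only, and v |-> v E
  is a restricted growth word (a rigid surjection) of length q^m onto q^k. Conversely a
  restricted growth word onto q^m is the list of rows of an echelon matrix, and composition of
  words is multiplication of matrices. So the dual Ramsey theorem of Graham and Rothschild applies;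
  it is derived from the Hales-Jewett theorem by induction on the number of parameters, for all
  numbers of constants at once.
*)

theory Submission
  imports Defs
begin

text \<open>A word with \<open>Suc k\<close> parameters, cut at the first occurrence of its first
  parameter \<open>a\<close>, leaves a prefix of constants and a tail with \<open>k\<close>
  parameters in which \<open>a\<close> may recur freely, that is, as one more constant. This is why
  the induction must cover every number of constants. The induction hypothesis disposes of the tail,
  but prefixes come in all lengths, so one application per length has to be made without spoiling
  the others. The remaining dependence on the prefix is reduced by Hales-Jewett to its length, and
  the pigeonhole principle selects lengths of one colour. Positions of other lengths are filled with
  a constant, whence the condition \<open>0 < a\<close>; words without constants are covered because
  their first letter \<open>0\<close> can serve as one. In the transfer, the two factors are read
  differently: \<open>E\<close> is the table of a linear map, a special word of length
  \<open>q ^ m\<close>, whereas \<open>R\<close> is an arbitrary word, read as a list of rows, so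
  \<open>n\<close> is not tied to powers of \<open>q\<close>.\<close>

text \<open>Only finitely many functions from \<open>I\<close> to \<open>r\<close> exist, so the
  colours at all indices of \<open>I\<close> can be packed into one. A Ramsey statement applied to
  \<open>enc\<close> then settles all indices at once.\<close>

lemma encode_family:
  assumes "finite I"
  shows "\<exists>s (enc :: ('i \<Rightarrow> nat) \<Rightarrow> nat). \<forall>f. (\<forall>i. f i < r) \<longrightarrow>
           enc f < s \<and> (\<forall>g. (\<forall>i. g i < r) \<and> enc f = enc g \<longrightarrow> (\<forall>i\<in>I. f i = g i))"
proof -
  have fin: "finite (I \<rightarrow>\<^sub>E {..<r})" using assms by (simp add: finite_PiE)
  obtain h where h: "bij_betw h (I \<rightarrow>\<^sub>E {..<r}) {0..<card (I \<rightarrow>\<^sub>E {..<r})}"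
    using ex_bij_betw_finite_nat[OF fin] by blast
  have mem: "restrict f I \<in> I \<rightarrow>\<^sub>E {..<r}" if "\<forall>i. f i < r" for f using that by auto
  show ?thesis
  proof (intro exI allI impI conjI)
    fix f :: "'i \<Rightarrow> nat" assume f: "\<forall>i. f i < r"
    show "h (restrict f I) < card (I \<rightarrow>\<^sub>E {..<r})"
      using bij_betwE[OF h] mem[OF f] by simp
    fix g assume g: "(\<forall>i. g i < r) \<and> h (restrict f I) = h (restrict g I)"
    then have "restrict f I = restrict g I"
      using h mem[OF f] mem[of g] by (auto simp: bij_betw_def inj_on_def)
    then show "\<forall>i\<in>I. f i = g i" by (metis restrict_apply')
  qed
qed

subsection \<open>The Hales--Jewett theorem\<close>

text \<open>\<open>None\<close> is the variable of a Hales-Jewett word, so a combinatorial line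
  consists of the words \<open>fill x W\<close>.\<close>

definition fill :: "'a \<Rightarrow> 'a option list \<Rightarrow> 'a list" where
  "fill x W = map (case_option x id) W"

lemma fill_append [simp]: "fill x (V @ W) = fill x V @ fill x W"
  by (simp add: fill_def)

lemma fill_map_Some [simp]: "fill x (map Some u) = u"
  by (simp add: fill_def map_idI)

definition var_words :: "'a set \<Rightarrow> nat \<Rightarrow> 'a option list set" where
  "var_words A n = {W. length W = n \<and> None \<in> set W \<and> set W \<subseteq> insert None (Some ` A)}"

definition const_words :: "'a set \<Rightarrow> nat \<Rightarrow> 'a list set" where
  "const_words A n = {w. length w = n \<and> set w \<subseteq> A}"

lemma finite_const_words: "finite A \<Longrightarrow> finite (const_words A n)"
  using finite_lists_length_eq[of A n] by (simp add: const_words_def conj_commute)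

lemma fill_in_const_words:
  "W \<in> var_words A n \<Longrightarrow> x \<in> A \<Longrightarrow> fill x W \<in> const_words A n"
  unfolding var_words_def const_words_def fill_def by (auto split: option.splits)

lemma var_words_append:
  assumes "set V \<subseteq> insert None (Some ` A)" "set W \<subseteq> insert None (Some ` A)"
    "None \<in> set V \<or> None \<in> set W" "length V + length W = n"
  shows "V @ W \<in> var_words A n"
  using assms by (auto simp: var_words_def)

definition has_line :: "'a set \<Rightarrow> nat \<Rightarrow> ('a list \<Rightarrow> nat) \<Rightarrow> bool" where
  "has_line A n c \<longleftrightarrow> (\<exists>W\<in>var_words A n. \<exists>\<gamma>. \<forall>x\<in>A. c (fill x W) = \<gamma>)"

text \<open>Colour focusing: the lines meet in \<open>f\<close> at the new letter \<open>b\<close>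
  and are monochromatic on the old letters. Indexing them by a set \<open>K\<close> of colours makes
  their colours distinct, which bounds \<open>card K\<close>.\<close>

definition focused :: "'a set \<Rightarrow> 'a \<Rightarrow> nat \<Rightarrow> ('a list \<Rightarrow> nat) \<Rightarrow> nat set \<Rightarrow> bool" where
  "focused A b n c K \<longleftrightarrow> (\<exists>f\<in>const_words (insert b A) n. \<forall>\<gamma>\<in>K.
     \<exists>W\<in>var_words (insert b A) n. fill b W = f \<and> (\<forall>x\<in>A. c (fill x W) = \<gamma>))"

text \<open>A line \<open>V\<close> for the packed colouring makes the colour after every
  \<open>u\<close> of length \<open>n\<close> independent of the letter of \<open>A\<close> put into
  \<open>V\<close>. The first \<open>n\<close> letters carry a full line or \<open>s\<close> focused
  ones. In the latter case the colour of the focus either completes one of these to a full line, or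
  is new, and the focus followed by \<open>V\<close> is the extra line.\<close>

lemma focusing_step:
  assumes A: "finite A" "A \<noteq> {}"
    and HJ: "\<And>r. \<exists>n. \<forall>c :: 'a list \<Rightarrow> nat. (\<forall>w. c w < r) \<longrightarrow> has_line A n c"
    and IH: "\<forall>c :: 'a list \<Rightarrow> nat. (\<forall>w. c w < r) \<longrightarrow> has_line (insert b A) n c \<or>
          (\<exists>K. finite K \<and> card K = s \<and> focused A b n c K)"
  shows "\<exists>n. \<forall>c :: 'a list \<Rightarrow> nat. (\<forall>w. c w < r) \<longrightarrow> has_line (insert b A) n c \<or>
          (\<exists>K. finite K \<and> card K = Suc s \<and> focused A b n c K)"
proof -
  let ?B = "insert b A"
  obtain r' and enc :: "('a list \<Rightarrow> nat) \<Rightarrow> nat" where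
    enc: "\<And>f. (\<forall>i. f i < r) \<Longrightarrow> enc f < r'"
    and enc_eq: "\<And>f g u. \<lbrakk>\<forall>i. f i < r; \<forall>i. g i < r; enc f = enc g; u \<in> const_words ?B n\<rbrakk>
        \<Longrightarrow> f u = g u"
  proof -
    have "finite (const_words ?B n)" using A(1) by (simp add: finite_const_words)
    from encode_family[OF this, of r] obtain s' and enc :: "('a list \<Rightarrow> nat) \<Rightarrow> nat" where
      "\<forall>f. (\<forall>i. f i < r) \<longrightarrow> enc f < s' \<and>
         (\<forall>g. (\<forall>i. g i < r) \<and> enc f = enc g \<longrightarrow> (\<forall>i\<in>const_words ?B n. f i = g i))" by blast
    then show thesis by (intro that[of enc s']) blast+
  qed
  obtain N where N: "\<And>c :: 'a list \<Rightarrow> nat. (\<forall>w. c w < r') \<Longrightarrow> has_line A N c"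
    using HJ[of r'] by blast
  show ?thesis
  proof (intro exI[of _ "n + N"] allI impI)
    fix c :: "'a list \<Rightarrow> nat" assume c: "\<forall>w. c w < r"
    have "has_line A N (\<lambda>v. enc (\<lambda>u. c (u @ v)))"
      by (rule N) (simp add: enc c)
    then obtain V \<gamma> where V: "V \<in> var_words A N"
      and V\<gamma>: "\<And>x. x \<in> A \<Longrightarrow> enc (\<lambda>u. c (u @ fill x V)) = \<gamma>"
      unfolding has_line_def by auto
    obtain a where a: "a \<in> A" using A(2) by blast
    have Veq: "c (u @ fill x V) = c (u @ fill a V)" if "x \<in> A" "u \<in> const_words ?B n" for x u
      using enc_eq[of "\<lambda>u. c (u @ fill x V)" "\<lambda>u. c (u @ fill a V)" u] V\<gamma> that a c by auto
    have Vset: "set V \<subseteq> insert None (Some ` ?B)" "length V = N" "None \<in> set V"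
      using V by (auto simp: var_words_def)
    have Va: "fill a V \<in> const_words A N" using fill_in_const_words[OF V a] .
    have extend: "has_line ?B (n + N) c"
      if W: "W \<in> var_words ?B n" "\<And>x. x \<in> ?B \<Longrightarrow> c (fill x W @ fill a V) = \<delta>" for W \<delta>
      unfolding has_line_def
    proof (intro bexI[of _ "W @ map Some (fill a V)"] exI[of _ \<delta>] ballI)
      show "W @ map Some (fill a V) \<in> var_words ?B (n + N)"
        using W(1) Va by (intro var_words_append) (auto simp: var_words_def const_words_def)
    qed (use W(2) in simp)
    have "has_line ?B n (\<lambda>u. c (u @ fill a V)) \<or>
        (\<exists>K. finite K \<and> card K = s \<and> focused A b n (\<lambda>u. c (u @ fill a V)) K)"
      using IH[rule_format, of "\<lambda>u. c (u @ fill a V)"] c by simp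
    then show "has_line ?B (n + N) c \<or> (\<exists>K. finite K \<and> card K = Suc s \<and> focused A b (n + N) c K)"
    proof (elim disjE exE conjE)
      assume "has_line ?B n (\<lambda>u. c (u @ fill a V))"
      then obtain W \<delta> where "W \<in> var_words ?B n" "\<forall>x\<in>?B. c (fill x W @ fill a V) = \<delta>"
        unfolding has_line_def by blast
      then show ?thesis using extend by blast
    next
      fix K assume K: "finite K" "card K = s" "focused A b n (\<lambda>u. c (u @ fill a V)) K"
      then obtain f where f: "f \<in> const_words ?B n"
        and lines: "\<And>\<gamma>. \<gamma> \<in> K \<Longrightarrow> \<exists>W\<in>var_words ?B n. fill b W = f \<and>
            (\<forall>x\<in>A. c (fill x W @ fill a V) = \<gamma>)"
        unfolding focused_def by auto
      define \<delta> where "\<delta> = c (f @ fill a V)"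
      show ?thesis
      proof (cases "\<delta> \<in> K")
        case True
        then obtain W where "W \<in> var_words ?B n" "fill b W = f"
          "\<forall>x\<in>A. c (fill x W @ fill a V) = \<delta>" using lines by blast
        then show ?thesis using extend[of W \<delta>] \<delta>_def by auto
      next
        case False
        have "focused A b (n + N) c (insert \<delta> K)"
          unfolding focused_def
        proof (intro bexI[of _ "f @ fill b V"] ballI)
          show "f @ fill b V \<in> const_words ?B (n + N)"
            using f Vset fill_in_const_words[of V ?B N b]
            by (auto simp: const_words_def var_words_def)
          fix \<gamma> assume "\<gamma> \<in> insert \<delta> K"
          then show "\<exists>W\<in>var_words ?B (n + N). fill b W = f @ fill b V \<and> (\<forall>x\<in>A. c (fill x W) = \<gamma>)"
          proof
            assume \<gamma>: "\<gamma> = \<delta>"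
            show ?thesis
            proof (intro bexI[of _ "map Some f @ V"] conjI ballI)
              show "map Some f @ V \<in> var_words ?B (n + N)"
                using f Vset by (intro var_words_append) (auto simp: const_words_def)
              show "c (fill x (map Some f @ V)) = \<gamma>" if "x \<in> A" for x
                using Veq[OF that f] \<gamma> \<delta>_def by simp
            qed simp
          next
            assume "\<gamma> \<in> K"
            then obtain W where W: "W \<in> var_words ?B n" "fill b W = f"
              "\<forall>x\<in>A. c (fill x W @ fill a V) = \<gamma>" using lines by blast
            show ?thesis
            proof (intro bexI[of _ "W @ V"] conjI ballI)
              show "W @ V \<in> var_words ?B (n + N)"
                using W Vset by (intro var_words_append) (auto simp: var_words_def)
              show "c (fill x (W @ V)) = \<gamma>" if "x \<in> A" for x
                using Veq[OF that, of "fill x W"] fill_in_const_words[OF W(1), of x] W(3) that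
                by simp
            qed (simp add: W)
          qed
        qed
        then show ?thesis using K(1,2) False by (intro disjI2 exI[of _ "insert \<delta> K"]) simp
      qed
    qed
  qed
qed

lemma focused_colours:
  assumes "focused A b n c K" "\<forall>w. c w < r" "A \<noteq> {}"
  shows "K \<subseteq> {..<r}"
proof
  obtain a where a: "a \<in> A" using assms(3) by blast
  fix \<gamma> assume "\<gamma> \<in> K"
  then obtain W where "\<forall>x\<in>A. c (fill x W) = \<gamma>" using assms(1) unfolding focused_def by blast
  then show "\<gamma> \<in> {..<r}" using a assms(2) by auto
qed

theorem hales_jewett:
  assumes "finite A"
  shows "\<exists>n. \<forall>c :: 'a list \<Rightarrow> nat. (\<forall>w. c w < r) \<longrightarrow> has_line A n c"
  using assms
proof (induction A arbitrary: r rule: finite_induct)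
  case empty
  have "[None] \<in> var_words ({} :: 'a set) 1" by (simp add: var_words_def)
  then show ?case unfolding has_line_def by blast
next
  case (insert b A)
  show ?case
  proof (cases "A = {}")
    \<comment> \<open>One-letter alphabets are separate because focusing takes a reference letter
      from \<open>A\<close>.\<close>
    case True
    have "[None] \<in> var_words {b} 1" by (simp add: var_words_def)
    then show ?thesis unfolding has_line_def True by blast
  next
    case False
    have "\<exists>n. \<forall>c :: 'a list \<Rightarrow> nat. (\<forall>w. c w < r) \<longrightarrow> has_line (insert b A) n c \<or>
          (\<exists>K. finite K \<and> card K = s \<and> focused A b n c K)" for s
    proof (induction s)
      case 0
      have "focused A b 0 c {}" for c :: "'a list \<Rightarrow> nat"
        by (simp add: focused_def const_words_def)
      then show ?case by (metis card.empty finite.emptyI)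
    next
      case (Suc s)
      then obtain n where "\<forall>c :: 'a list \<Rightarrow> nat. (\<forall>w. c w < r) \<longrightarrow>
          has_line (insert b A) n c \<or> (\<exists>K. finite K \<and> card K = s \<and> focused A b n c K)" by blast
      from focusing_step[OF insert.hyps(1) False insert.IH this] show ?case .
    qed
    \<comment> \<open>With only \<open>r\<close> colours, \<open>Suc r\<close> focused colours
      cannot occur, so a line must.\<close>
    from this[of "Suc r"] obtain n where n: "\<And>c :: 'a list \<Rightarrow> nat. (\<forall>w. c w < r) \<Longrightarrow>
        has_line (insert b A) n c \<or> (\<exists>K. finite K \<and> card K = Suc r \<and> focused A b n c K)"
      by blast
    have "has_line (insert b A) n c" if c: "\<forall>w. c w < r" for c :: "'a list \<Rightarrow> nat"
    proof (rule ccontr)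
      assume "\<not> ?thesis"
      with n[OF c] obtain K where "card K = Suc r" "focused A b n c K" by blast
      with focused_colours[OF _ c False] card_mono[of "{..<r}" K] show False by simp
    qed
    then show ?thesis by blast
  qed
qed

subsection \<open>Restricted growth words\<close>

text \<open>The letters below \<open>a\<close> are constants; each later letter is an old one or the next
  unused number, and \<open>b\<close> is the number of letters available at the end.\<close>

fun rgs :: "nat \<Rightarrow> nat \<Rightarrow> nat list \<Rightarrow> bool" where
  "rgs a b [] \<longleftrightarrow> a = b"
| "rgs a b (x # w) \<longleftrightarrow> x < a \<and> rgs a b w \<or> x = a \<and> rgs (Suc a) b w"

lemma rgs_le: "rgs a b w \<Longrightarrow> a \<le> b"
  by (induction a b w rule: rgs.induct) auto

lemma rgs_set: "rgs a b w \<Longrightarrow> set w \<subseteq> {..<b}"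
proof (induction a b w rule: rgs.induct)
  case (2 a b x w)
  then show ?case using rgs_le[of a b w] rgs_le[of "Suc a" b w] by auto
qed simp

lemma rgs_append: "rgs a b (u @ v) \<longleftrightarrow> (\<exists>d. rgs a d u \<and> rgs d b v)"
  by (induction u arbitrary: a) auto

lemma rgs_const: "rgs a a w \<longleftrightarrow> set w \<subseteq> {..<a}"
  using rgs_le by (induction w) fastforce+

lemma rgs_upt: "a \<le> b \<Longrightarrow> rgs a b [a..<b]"
  by (induction "b - a" arbitrary: a) (auto simp: upt_conv_Cons)

lemma rgs_split:
  assumes "rgs a b w" "a \<le> d" "d < b"
  shows "\<exists>v. w = takeWhile (\<lambda>x. x < d) w @ d # v \<and> rgs a d (takeWhile (\<lambda>x. x < d) w) \<and> rgs (Suc d) b v"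
  using assms
proof (induction a b w rule: rgs.induct)
  case (2 a b x w)
  show ?case
  proof (cases "x < a")
    case True
    then show ?thesis using 2 by auto
  next
    case False
    then have "x = a" "rgs (Suc a) b w" using 2 by auto
    then show ?thesis using 2 by (cases "a = d") auto
  qed
qed simp

text \<open>\<open>map (sub a E) R\<close> is the composition of parameter words: constants are
  fixed, and \<open>a + i\<close> is parameter number \<open>i\<close> of \<open>R\<close>.\<close>

definition sub :: "nat \<Rightarrow> nat list \<Rightarrow> nat \<Rightarrow> nat" where
  "sub a E i = (if i < a then i else E ! (i - a))"

lemma map_sub_const: "set w \<subseteq> {..<a} \<Longrightarrow> map (sub a E) w = w"
  by (rule map_idI) (auto simp: sub_def)

lemma map_sub_upt: "map (sub a E) [a..<a + length E] = E"
  by (rule nth_equalityI) (auto simp: sub_def)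

lemma map_sub_prefix:
  "set R \<subseteq> {..<a + length u} \<Longrightarrow> map (sub a (u @ v)) R = map (sub a u) R"
  by (auto simp: sub_def nth_append)

lemma map_sub_assoc:
  assumes "set R \<subseteq> {..<a + length E}"
  shows "map (sub a D) (map (sub a E) R) = map (sub a (map (sub a D) E)) R"
  using assms by (auto simp: sub_def)

text \<open>Invariant while \<open>R\<close> is read: with \<open>d\<close> letters of
  \<open>R\<close> available, the first \<open>d - a\<close> entries of \<open>E\<close> have been
  introduced and make \<open>e\<close> letters available. A new letter \<open>d\<close> of
  \<open>R\<close> calls up the next entry of \<open>E\<close>, which is old or equal to
  \<open>e\<close>.\<close>

lemma rgs_sub_aux:
  assumes "rgs d b R" "a \<le> d" "length E = b - a"
    "rgs a e (take (d - a) E)" "rgs e c (drop (d - a) E)"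
  shows "rgs e c (map (sub a E) R)"
  using assms
proof (induction d b R arbitrary: e rule: rgs.induct)
  case (2 d b x R)
  have ae: "a \<le> e" using 2 rgs_le by blast
  show ?case
  proof (cases "x < d")
    case True
    have "sub a E x < e"
    proof (cases "x < a")
      case False
      then have "E ! (x - a) \<in> set (take (d - a) E)"
        using True 2 rgs_le[of d b R] by (auto simp: in_set_conv_nth intro!: exI[of _ "x - a"])
      then show ?thesis using rgs_set[OF 2(6)] False by (auto simp: sub_def)
    qed (use ae in \<open>auto simp: sub_def\<close>)
    moreover have "rgs e c (map (sub a E) R)" using 2 True by auto
    ultimately show ?thesis by simp
  next
    case False
    then have x: "x = d" "rgs (Suc d) b R" using 2 by auto
    define y where "y = E ! (d - a)"
    have lt: "d - a < length E" using rgs_le[OF x(2)] 2 by auto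
    have tk: "take (Suc d - a) E = take (d - a) E @ [y]"
      using lt 2(4) by (simp add: y_def Suc_diff_le take_Suc_conv_app_nth)
    have dr: "drop (d - a) E = y # drop (Suc d - a) E"
      using lt 2(4) by (simp add: y_def Suc_diff_le Cons_nth_drop_Suc)
    have subx: "sub a E x = y" using x 2(4) by (simp add: sub_def y_def)
    from 2(7) dr consider "y < e" "rgs e c (drop (Suc d - a) E)"
      | "y = e" "rgs (Suc e) c (drop (Suc d - a) E)" by auto
    then show ?thesis
    proof cases
      case 1
      have "rgs a e (take (Suc d - a) E)" using tk 1 2(6) by (auto simp: rgs_append)
      then show ?thesis using 2(2)[of e] x 2 1 subx by auto
    next
      case 2
      have "rgs a (Suc e) (take (Suc d - a) E)"
        using tk 2 "2.prems"(4) by (auto simp: rgs_append)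
      then show ?thesis using "2.IH"(2)[of "Suc e"] x "2.prems" 2 subx by auto
    qed
  qed
qed auto

lemma rgs_sub:
  assumes "rgs a b R" "length E = b - a" "rgs a c E"
  shows "rgs a c (map (sub a E) R)"
  using rgs_sub_aux[of a b R a E a c] assms by simp

text \<open>The \<open>k\<close>-parameter words of Graham and Rothschild over \<open>a\<close>
  constants, with parameters numbered by first occurrence; for \<open>a = 0\<close> these are the
  rigid surjections of \<open>n\<close> onto \<open>k\<close>.\<close>

definition gr_words :: "nat \<Rightarrow> nat \<Rightarrow> nat \<Rightarrow> nat list set" where
  "gr_words a k n = {w. length w = n \<and> rgs a (a + k) w}"

lemma gr_words_sub:
  assumes "R \<in> gr_words a m n" "E \<in> gr_words a k m"
  shows "map (sub a E) R \<in> gr_words a k n"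
  using assms rgs_sub[of a "a + m" R E "a + k"] by (simp add: gr_words_def)

lemma gr_words_0: "gr_words a 0 n = const_words {..<a} n"
  by (auto simp: gr_words_def const_words_def rgs_const)

lemma gr_words_upt: "[a..<a + m] \<in> gr_words a m m"
  by (simp add: gr_words_def rgs_upt)

lemma gr_words_set: "w \<in> gr_words a k n \<Longrightarrow> set w \<subseteq> {..<a + k}"
  using rgs_set[of a "a + k" w] by (simp add: gr_words_def)

lemma gr_words_sub_assoc:
  assumes "R \<in> gr_words a m n" "E \<in> gr_words a k m"
  shows "map (sub a D) (map (sub a E) R) = map (sub a (map (sub a D) E)) R"
  using assms by (intro map_sub_assoc) (auto simp: gr_words_def dest: rgs_set)

lemma gr_words_split:
  assumes "w \<in> gr_words a (Suc k) n"
  obtains v y where "w = v @ a # y" "v \<in> const_words {..<a} (length v)"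
    "y \<in> gr_words (Suc a) k (n - Suc (length v))" "length v < n"
proof -
  obtain y where y: "w = takeWhile (\<lambda>x. x < a) w @ a # y"
     "rgs a a (takeWhile (\<lambda>x. x < a) w)" "rgs (Suc a) (a + Suc k) y"
    using rgs_split[of a "a + Suc k" w a] assms by (auto simp: gr_words_def)
  have "length w = length (takeWhile (\<lambda>x. x < a) w) + Suc (length y)"
    by (subst y(1)) simp
  then show ?thesis using assms y
    by (intro that[OF y(1)]) (auto simp: gr_words_def const_words_def rgs_const)
qed

lemma gr_words_join:
  assumes "v \<in> const_words {..<a} i" "y \<in> gr_words (Suc a) k n"
  shows "v @ a # y \<in> gr_words a (Suc k) (i + Suc n)"
proof -
  have "rgs a a v" using assms(1) by (simp add: const_words_def rgs_const)
  then show ?thesis using assms unfolding gr_words_def const_words_def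
    by (auto simp: rgs_append intro!: exI[of _ a])
qed

section \<open>The Graham-Rothschild theorem for parameter words\<close>

text \<open>\<open>m\<close> and \<open>r\<close> are bound inside because the induction step uses
  the statement with other numbers of parameters and with packed colours.\<close>

definition GR :: "nat \<Rightarrow> nat \<Rightarrow> bool" where
  "GR a k \<longleftrightarrow> (\<forall>m r. \<exists>n. \<forall>c :: nat list \<Rightarrow> nat. (\<forall>w. c w < r) \<longrightarrow>
     (\<exists>R\<in>gr_words a m n. \<exists>\<gamma>. \<forall>E\<in>gr_words a k m. c (map (sub a E) R) = \<gamma>))"

text \<open>The first variable block introduces all \<open>m\<close> parameters in order; every
  later block uses letters below \<open>a + m\<close> only.\<close>

lemma rgs_concat:
  assumes "None \<in> set W" "set W \<subseteq> insert None (Some ` const_words {..<a} m)"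
  shows "rgs a (a + m) (concat (fill [a..<a + m] W))"
  using assms
proof (induction W)
  case (Cons z W)
  have const: "rgs (a + m) (a + m) (concat (fill [a..<a + m] W))"
  proof -
    have "set (case_option [a..<a + m] id y) \<subseteq> {..<a + m}" if "y \<in> set W" for y
      using that Cons.prems by (fastforce simp: const_words_def split: option.splits)
    then show ?thesis unfolding rgs_const fill_def by auto
  qed
  show ?case
  proof (cases z)
    case None
    then show ?thesis using const rgs_upt[of a "a + m"] by (auto simp: fill_def rgs_append)
  next
    case (Some u)
    then have "rgs a a u" using Cons.prems by (auto simp: rgs_const const_words_def)
    moreover have "rgs a (a + m) (concat (fill [a..<a + m] W))" using Cons Some by auto
    ultimately show ?thesis using Some by (auto simp: fill_def rgs_append)
  qed
qed simp

text \<open>Without parameters, the words \<open>E\<close> are the constant words of length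
  \<open>m\<close>; they become the letters of a Hales-Jewett alphabet. Replacing the variable of a
  line by the block of all parameters gives \<open>R\<close>, and substituting \<open>E\<close> into
  \<open>R\<close> yields the point of the line at \<open>E\<close>.\<close>

lemma GR_0: "GR a 0"
  unfolding GR_def
proof (intro allI)
  fix m r
  let ?A = "const_words {..<a} m"
  obtain N where N: "\<And>c :: nat list list \<Rightarrow> nat. (\<forall>w. c w < r) \<Longrightarrow> has_line ?A N c"
    using hales_jewett[OF finite_const_words[of "{..<a}" m], of r] by auto
  show "\<exists>n. \<forall>c :: nat list \<Rightarrow> nat. (\<forall>w. c w < r) \<longrightarrow>
     (\<exists>R\<in>gr_words a m n. \<exists>\<gamma>. \<forall>E\<in>gr_words a 0 m. c (map (sub a E) R) = \<gamma>)"
  proof (intro exI[of _ "N * m"] allI impI)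
    fix c :: "nat list \<Rightarrow> nat" assume "\<forall>w. c w < r"
    then have "has_line ?A N (\<lambda>L. c (concat L))" by (intro N) simp
    then obtain W \<gamma> where W: "W \<in> var_words ?A N"
      and \<gamma>: "\<And>x. x \<in> ?A \<Longrightarrow> c (concat (fill x W)) = \<gamma>" unfolding has_line_def by auto
    let ?R = "concat (fill [a..<a + m] W)"
    have Wset: "None \<in> set W" "set W \<subseteq> insert None (Some ` ?A)" "length W = N"
      using W by (auto simp: var_words_def)
    have len: "length (concat (fill x V)) = length V * m"
      if "length x = m" "set V \<subseteq> insert None (Some ` ?A)" for x V
      using that by (induction V) (auto simp: fill_def const_words_def)
    have R: "?R \<in> gr_words a m (N * m)"
      using rgs_concat[OF Wset(1,2)] len[OF _ Wset(2)] Wset(3) by (simp add: gr_words_def)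
    have sub: "map (sub a E) (concat (fill [a..<a + m] V)) = concat (fill E V)"
      if E: "E \<in> ?A" and V: "set V \<subseteq> insert None (Some ` ?A)" for E V
      using V
    proof (induction V)
      case (Cons z V)
      have "map (sub a E) (case_option [a..<a + m] id z) = case_option E id z"
        using Cons.prems map_sub_upt[of a E] E
        by (auto simp: const_words_def map_sub_const simp del: map_map split: option.splits)
      then show ?case using Cons by (simp add: fill_def)
    qed (simp add: fill_def)
    show "\<exists>R\<in>gr_words a m (N * m). \<exists>\<gamma>. \<forall>E\<in>gr_words a 0 m. c (map (sub a E) R) = \<gamma>"
      using R sub[OF _ Wset(2)] \<gamma> by (auto simp: gr_words_0 intro!: bexI[of _ ?R])
  qed
qed

lemma rgs_unique: "rgs a b w \<Longrightarrow> rgs a b' w \<Longrightarrow> b = b'"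
  by (induction a b w rule: rgs.induct) auto

lemma gr_words_tail:
  assumes "v @ a # y \<in> gr_words a (Suc k) n" "v \<in> const_words {..<a} (length v)"
  shows "y \<in> gr_words (Suc a) k (n - Suc (length v))"
proof -
  obtain d where d: "rgs a d v" "rgs d (a + Suc k) (a # y)"
    using assms(1) by (auto simp: gr_words_def rgs_append)
  have "d = a"
    using rgs_unique[OF d(1)] assms(2) by (simp add: const_words_def rgs_const)
  with d assms show ?thesis by (auto simp: gr_words_def)
qed

lemma rgs_shift:
  "rgs d b w \<Longrightarrow> a \<le> d \<Longrightarrow> rgs (d + j) (b + j) (map (\<lambda>x. if x < a then x else x + j) w)"
  by (induction d b w rule: rgs.induct) auto

text \<open>Fusion: in step \<open>j\<close> the first \<open>Suc j\<close> parameters stay free and only the later ones are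
  identified, so that what was achieved for shorter prefixes survives. The replacement word uses
  none of the parameters \<open>a, ..., a + j - 1\<close>, whence one word serves all prefixes of length \<open>j\<close>.\<close>

lemma fusion:
  assumes "GR (Suc a) k"
  shows "\<exists>n. \<forall>c :: nat list \<Rightarrow> nat. (\<forall>w. c w < r) \<longrightarrow>
    (\<exists>R\<in>gr_words a (j + N) n. \<forall>i<j. \<forall>w\<in>const_words {..<a} i.
       \<forall>X\<in>gr_words (Suc a) k (j + N - Suc i). \<forall>X'\<in>gr_words (Suc a) k (j + N - Suc i).
         c (map (sub a (w @ a # X)) R) = c (map (sub a (w @ a # X')) R))"
proof (induction j arbitrary: N)
  case 0
  show ?case using gr_words_upt[of a N] by (intro exI[of _ N]) auto
next
  case (Suc j)
  obtain s and enc :: "(nat list \<Rightarrow> nat) \<Rightarrow> nat" where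
    enc: "\<forall>f. (\<forall>i. f i < r) \<longrightarrow> enc f < s \<and>
      (\<forall>g. (\<forall>i. g i < r) \<and> enc f = enc g \<longrightarrow> (\<forall>i\<in>const_words {..<a} j. f i = g i))"
    using encode_family[OF finite_const_words[of "{..<a}" j], of r] by auto
  obtain N' where N': "\<And>c :: nat list \<Rightarrow> nat. (\<forall>w. c w < s) \<Longrightarrow>
      \<exists>R\<in>gr_words (Suc a) N N'. \<exists>\<gamma>. \<forall>E\<in>gr_words (Suc a) k N. c (map (sub (Suc a) E) R) = \<gamma>"
    using assms unfolding GR_def by blast
  \<comment> \<open>Of the \<open>Suc N'\<close> spare parameters, one will be the parameter that
    follows a prefix of length \<open>j\<close>; the other \<open>N'\<close> are identified
    according to \<open>S\<close>.\<close>
  obtain n where n: "\<And>c :: nat list \<Rightarrow> nat. (\<forall>w. c w < r) \<Longrightarrow>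
    \<exists>R\<in>gr_words a (j + Suc N') n. \<forall>i<j. \<forall>w\<in>const_words {..<a} i.
       \<forall>X\<in>gr_words (Suc a) k (j + Suc N' - Suc i). \<forall>X'\<in>gr_words (Suc a) k (j + Suc N' - Suc i).
         c (map (sub a (w @ a # X)) R) = c (map (sub a (w @ a # X')) R)"
    using Suc.IH[of "Suc N'"] by blast
  show ?case
  proof (intro exI[of _ n] allI impI)
    fix c :: "nat list \<Rightarrow> nat" assume c: "\<forall>w. c w < r"
    obtain R\<^sub>j where R\<^sub>j: "R\<^sub>j \<in> gr_words a (j + Suc N') n"
      and IH: "\<And>i w X X'. \<lbrakk>i < j; w \<in> const_words {..<a} i;
          X \<in> gr_words (Suc a) k (j + Suc N' - Suc i); X' \<in> gr_words (Suc a) k (j + Suc N' - Suc i)\<rbrakk>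
        \<Longrightarrow> c (map (sub a (w @ a # X)) R\<^sub>j) = c (map (sub a (w @ a # X')) R\<^sub>j)"
      using n[OF c] by blast
    define C where "C Y = enc (\<lambda>w. c (map (sub a (w @ a # Y)) R\<^sub>j))" for Y
    obtain S \<gamma> where S: "S \<in> gr_words (Suc a) N N'"
      and \<gamma>: "\<And>X. X \<in> gr_words (Suc a) k N \<Longrightarrow> C (map (sub (Suc a) X) S) = \<gamma>"
      using N'[of C] enc c by (auto simp: C_def)
    \<comment> \<open>In \<open>S\<close> the letter \<open>a\<close> counts as a constant. It is
      moved to \<open>a + j\<close>, the parameter that becomes \<open>a\<close> again when
      \<open>w @ a # Z\<close> with \<open>length w = j\<close> is substituted.\<close>
    define \<sigma> where "\<sigma> x = (if x < a then x else x + j)" for x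
    define R' where "R' = [a..<a + Suc j] @ map \<sigma> S"
    have R': "R' \<in> gr_words a (Suc j + N) (j + Suc N')"
    proof -
      have "rgs (Suc a + j) (Suc a + N + j) (map \<sigma> S)"
        using rgs_shift[of "Suc a" "Suc a + N" S a j] S by (simp add: gr_words_def \<sigma>_def[abs_def])
      moreover have "rgs a (a + Suc j) [a..<a + Suc j]" by (rule rgs_upt) simp
      ultimately have "rgs a (a + (Suc j + N)) R'"
        unfolding R'_def rgs_append
        by (intro exI[of _ "a + Suc j"]) (simp add: ac_simps)
      then show ?thesis using S by (simp add: gr_words_def R'_def)
    qed
    show "\<exists>R\<in>gr_words a (Suc j + N) n. \<forall>i<Suc j. \<forall>w\<in>const_words {..<a} i.
       \<forall>X\<in>gr_words (Suc a) k (Suc j + N - Suc i). \<forall>X'\<in>gr_words (Suc a) k (Suc j + N - Suc i).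
         c (map (sub a (w @ a # X)) R) = c (map (sub a (w @ a # X')) R)"
    proof (intro bexI[of _ "map (sub a R') R\<^sub>j"] allI impI ballI)
      show "map (sub a R') R\<^sub>j \<in> gr_words a (Suc j + N) n"
        using gr_words_sub[OF R\<^sub>j R'] .
      fix i w X X' assume i: "i < Suc j" and w: "w \<in> const_words {..<a} i"
        and X: "X \<in> gr_words (Suc a) k (Suc j + N - Suc i)"
        and X': "X' \<in> gr_words (Suc a) k (Suc j + N - Suc i)"
      have lw: "length w = i" using w by (simp add: const_words_def)
      have assoc: "map (sub a D) (map (sub a R') R\<^sub>j) = map (sub a (map (sub a D) R')) R\<^sub>j" for D
        by (rule gr_words_sub_assoc[OF R\<^sub>j R'])
      have head: "map (sub a (w @ a # Z)) [a..<a + Suc i] = w @ [a]" for Z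
      proof -
        have "map (sub a ((w @ [a]) @ Z)) [a..<a + Suc i] = map (sub a (w @ [a])) [a..<a + Suc i]"
          using lw by (intro map_sub_prefix) auto
        then show ?thesis using map_sub_upt[of a "w @ [a]"] unfolding length_append_singleton lw
          by (simp only: append_assoc append_Cons append_Nil)
      qed
      show "c (map (sub a (w @ a # X)) (map (sub a R') R\<^sub>j)) =
          c (map (sub a (w @ a # X')) (map (sub a R') R\<^sub>j))"
      proof (cases "i = j")
        case True
        have "sub a (w @ a # Z) (\<sigma> x) = sub (Suc a) Z x" for Z x
          using lw True by (auto simp: sub_def \<sigma>_def nth_append nth_Cons')
        then have comp: "map (sub a (w @ a # Z)) R' = w @ a # map (sub (Suc a) Z) S" for Z
          unfolding R'_def using head[of Z] True by simp
        have "C (map (sub (Suc a) X) S) = C (map (sub (Suc a) X') S)"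
          using \<gamma> X X' True by simp
        then have "c (map (sub a (w @ a # map (sub (Suc a) X) S)) R\<^sub>j) =
            c (map (sub a (w @ a # map (sub (Suc a) X') S)) R\<^sub>j)"
          using enc[rule_format, of "\<lambda>w. c (map (sub a (w @ a # map (sub (Suc a) X) S)) R\<^sub>j)",
              THEN conjunct2, rule_format, OF _ conjI,
              of "\<lambda>w. c (map (sub a (w @ a # map (sub (Suc a) X') S)) R\<^sub>j)" w]
            c w True unfolding C_def by simp
        then show ?thesis by (simp only: assoc comp)
      next
        case False
        then have ij: "i < j" using i by simp
        \<comment> \<open>For shorter prefixes, \<open>R'\<close> leaves \<open>w @ [a]\<close>
          intact and changes only the tail, so the independence already achieved is
          inherited.\<close>
        have tail: "\<exists>Y\<in>gr_words (Suc a) k (j + Suc N' - Suc i). map (sub a (w @ a # Z)) R' = w @ a # Y"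
          if Z: "Z \<in> gr_words (Suc a) k (Suc j + N - Suc i)" for Z
        proof -
          have "w @ a # Z \<in> gr_words a (Suc k) (Suc j + N)"
            using gr_words_join[OF w Z] ij by simp
          from gr_words_sub[OF R' this]
          have mem: "map (sub a (w @ a # Z)) R' \<in> gr_words a (Suc k) (j + Suc N')" .
          have "[a..<a + Suc j] = [a..<a + Suc i] @ [a + Suc i..<a + Suc j]"
            using upt_add_eq_append[of a "a + Suc i" "j - i"] ij by simp
          then have "map (sub a (w @ a # Z)) R' =
              w @ a # map (sub a (w @ a # Z)) ([a + Suc i..<a + Suc j] @ map \<sigma> S)"
            unfolding R'_def using head[of Z] by (simp del: upt_Suc)
          then show ?thesis using mem gr_words_tail w lw by metis
        qed
        from tail[OF X] tail[OF X'] show ?thesis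
          using IH[OF ij w] by (metis assoc)
      qed
    qed
  qed
qed

text \<open>After fusion the colour depends only on the constants before the first parameter; here
  it is reduced to the number of these constants.\<close>

lemma prefix_stage:
  "\<exists>N. \<forall>\<chi> :: nat list \<Rightarrow> nat. (\<forall>w. \<chi> w < r) \<longrightarrow> (\<exists>R\<in>gr_words a M N. \<forall>s<M. \<exists>\<gamma>.
     \<forall>w\<in>const_words {..<a} s. \<chi> (map (sub a w) (takeWhile (\<lambda>x. x < a + s) R)) = \<gamma>)"
proof (induction M)
  case 0
  show ?case using gr_words_upt[of a 0] by auto
next
  case (Suc M)
  then obtain N where N: "\<And>\<chi> :: nat list \<Rightarrow> nat. (\<forall>w. \<chi> w < r) \<Longrightarrow> \<exists>R\<in>gr_words a M N. \<forall>s<M. \<exists>\<gamma>.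
     \<forall>w\<in>const_words {..<a} s. \<chi> (map (sub a w) (takeWhile (\<lambda>x. x < a + s) R)) = \<gamma>" by blast
  obtain L where L: "\<And>\<chi> :: nat list \<Rightarrow> nat. (\<forall>w. \<chi> w < r) \<Longrightarrow>
      \<exists>R\<in>gr_words a N L. \<exists>\<gamma>. \<forall>E\<in>gr_words a 0 N. \<chi> (map (sub a E) R) = \<gamma>"
    using GR_0[of a] unfolding GR_def by blast
  show ?case
  proof (intro exI[of _ "Suc L"] allI impI)
    fix \<chi> :: "nat list \<Rightarrow> nat" assume \<chi>: "\<forall>w. \<chi> w < r"
    obtain R\<^sub>1 \<gamma>\<^sub>1 where R1: "R\<^sub>1 \<in> gr_words a N L"
      and \<gamma>1: "\<And>E. E \<in> gr_words a 0 N \<Longrightarrow> \<chi> (map (sub a E) R\<^sub>1) = \<gamma>\<^sub>1" using L[OF \<chi>] by blast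
    \<comment> \<open>A prefix \<open>v\<close> determines the composition with
      \<open>R\<^sub>1\<close> only up to the first parameter of \<open>R\<^sub>1\<close> beyond
      \<open>v\<close>; this initial part receives the colour.\<close>
    define \<chi>' where "\<chi>' v = \<chi> (map (sub a v) (takeWhile (\<lambda>x. x < a + length v) R\<^sub>1))" for v
    obtain R\<^sub>2 where R2: "R\<^sub>2 \<in> gr_words a M N"
      and \<chi>'2: "\<And>s. s < M \<Longrightarrow> \<exists>\<gamma>. \<forall>w\<in>const_words {..<a} s.
          \<chi>' (map (sub a w) (takeWhile (\<lambda>x. x < a + s) R\<^sub>2)) = \<gamma>"
      using N[of \<chi>'] \<chi> by (auto simp: \<chi>'_def)
    have R12: "map (sub a R\<^sub>2) R\<^sub>1 \<in> gr_words a M L" using gr_words_sub[OF R1 R2] .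
    \<comment> \<open>With a fresh parameter at the end, the prefix for \<open>s = M\<close> is the
      whole composed word, on which \<open>R\<^sub>1\<close> has already made the colour
      constant.\<close>
    let ?R = "map (sub a R\<^sub>2) R\<^sub>1 @ [a + M]"
    show "\<exists>R\<in>gr_words a (Suc M) (Suc L). \<forall>s<Suc M. \<exists>\<gamma>. \<forall>w\<in>const_words {..<a} s.
        \<chi> (map (sub a w) (takeWhile (\<lambda>x. x < a + s) R)) = \<gamma>"
    proof (intro bexI[of _ ?R] allI impI)
      show "?R \<in> gr_words a (Suc M) (Suc L)"
        using R12 by (auto simp: gr_words_def rgs_append)
      fix s assume "s < Suc M"
      then consider "s = M" | "s < M" by linarith
      then show "\<exists>\<gamma>. \<forall>w\<in>const_words {..<a} s.
          \<chi> (map (sub a w) (takeWhile (\<lambda>x. x < a + s) ?R)) = \<gamma>"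
      proof cases
        case 1
        have "takeWhile (\<lambda>x. x < a + M) ?R = map (sub a R\<^sub>2) R\<^sub>1"
          using gr_words_set[OF R12] by (subst takeWhile_append2) auto
        moreover have "\<chi> (map (sub a w) (map (sub a R\<^sub>2) R\<^sub>1)) = \<gamma>\<^sub>1"
          if "w \<in> const_words {..<a} M" for w
        proof -
          have w: "w \<in> gr_words a 0 M" using that by (simp add: gr_words_0)
          show ?thesis
            unfolding gr_words_sub_assoc[OF R1 R2] by (rule \<gamma>1) (rule gr_words_sub[OF R2 w])
        qed
        ultimately show ?thesis using 1 by metis
      next
        case 2
        define T where "T = takeWhile (\<lambda>x. x < a + s) R\<^sub>2"
        \<comment> \<open>The first \<open>a + s\<close> of \<open>R\<^sub>2\<close> is at position
          \<open>p\<close>, so in the composition it comes from the first \<open>a + p\<close> of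
          \<open>R\<^sub>1\<close>.\<close>
        define p where "p = length T"
        define P where "P = takeWhile (\<lambda>x. x < a + p) R\<^sub>1"
        obtain U where U: "R\<^sub>2 = T @ (a + s) # U" and T: "rgs a (a + s) T"
          using rgs_split[of a "a + M" R\<^sub>2 "a + s"] R2 2 by (auto simp: gr_words_def T_def)
        have "p < N" using R2 arg_cong[OF U, of length] by (simp add: gr_words_def p_def)
        then obtain V where V: "R\<^sub>1 = P @ (a + p) # V" and P: "rgs a (a + p) P"
          using rgs_split[of a "a + N" R\<^sub>1 "a + p"] R1 by (auto simp: gr_words_def P_def)
        have Pset: "set P \<subseteq> {..<a + length T}" using rgs_set[OF P] by (simp add: p_def)
        have "map (sub a R\<^sub>2) P = map (sub a T) P"
          unfolding U by (rule map_sub_prefix[OF Pset])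
        moreover have "sub a R\<^sub>2 (a + p) = a + s" unfolding U by (simp add: sub_def p_def)
        ultimately have R: "?R = map (sub a T) P @ (a + s) # (map (sub a R\<^sub>2) V @ [a + M])"
          by (subst V) simp
        have "rgs a (a + s) (map (sub a T) P)"
          using rgs_sub[OF P _ T] by (simp add: p_def)
        then have "set (map (sub a T) P) \<subseteq> {..<a + s}" by (rule rgs_set)
        then have tw: "takeWhile (\<lambda>x. x < a + s) ?R = map (sub a T) P"
          unfolding R by (subst takeWhile_append2) auto
        have "\<chi> (map (sub a w) (map (sub a T) P)) = \<chi>' (map (sub a w) T)" for w
          unfolding map_sub_assoc[OF Pset] \<chi>'_def by (simp add: P_def p_def)
        then show ?thesis using \<chi>'2[OF 2] tw unfolding T_def by metis
      qed
    qed
  qed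
qed

text \<open>Positions in \<open>S\<close> receive the parameters in order; \<open>0\<close> can fill
  the others because \<open>0 < a\<close> makes it a constant.\<close>

lemma gr_word_supported:
  assumes "0 < a" "S \<subseteq> {..<M}"
  shows "\<exists>R\<in>gr_words a (card S) M. \<forall>i<M. i \<notin> S \<longrightarrow> R ! i = 0"
  using assms(2)
proof (induction M arbitrary: S)
  case 0
  then show ?case by (auto simp: gr_words_def)
next
  case (Suc M)
  have fin: "finite S" using Suc.prems finite_subset by blast
  have "S - {M} \<subseteq> {..<M}" using Suc.prems by auto
  then obtain R where R: "R \<in> gr_words a (card (S - {M})) M" "\<forall>i<M. i \<notin> S - {M} \<longrightarrow> R ! i = 0"
    using Suc.IH by blast
  define x where "x = (if M \<in> S then a + card (S - {M}) else 0)"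
  have "R @ [x] \<in> gr_words a (card S) (Suc M)"
  proof (cases "M \<in> S")
    case True
    then have "card S = Suc (card (S - {M}))" using fin by (metis card_Suc_Diff1)
    then show ?thesis using R(1) True by (auto simp: gr_words_def rgs_append x_def)
  next
    case False
    then show ?thesis using R(1) assms(1)
      by (auto simp: gr_words_def rgs_append x_def intro!: exI[of _ "a + card S"])
  qed
  moreover have "\<forall>i<Suc M. i \<notin> S \<longrightarrow> (R @ [x]) ! i = 0"
    using R by (auto simp: x_def nth_append gr_words_def less_Suc_eq)
  ultimately show ?case by blast
qed

text \<open>The word is composed from three: \<open>Q\<close> makes the colour independent of the
  tail, \<open>P\<close> leaves only the length of the prefix, and \<open>Z\<close> allows the first
  \<open>a\<close> of a substituted word only at positions of one colour.\<close>

lemma GR_Suc: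
  assumes a: "0 < a" and "GR (Suc a) k"
  shows "GR a (Suc k)"
  unfolding GR_def
proof (intro allI)
  fix m r :: nat
  \<comment> \<open>Pigeonhole: among \<open>r * m\<close> prefix lengths with \<open>r\<close>
    colours, some \<open>m\<close> share a colour.\<close>
  define M where "M = r * m"
  obtain N where N: "\<And>\<chi> :: nat list \<Rightarrow> nat. (\<forall>w. \<chi> w < r) \<Longrightarrow> \<exists>R\<in>gr_words a M N. \<forall>s<M. \<exists>\<gamma>.
     \<forall>w\<in>const_words {..<a} s. \<chi> (map (sub a w) (takeWhile (\<lambda>x. x < a + s) R)) = \<gamma>"
    using prefix_stage by blast
  obtain n where n: "\<And>c :: nat list \<Rightarrow> nat. (\<forall>w. c w < r) \<Longrightarrow>
    \<exists>R\<in>gr_words a N n. \<forall>i<N. \<forall>w\<in>const_words {..<a} i.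
       \<forall>X\<in>gr_words (Suc a) k (N - Suc i). \<forall>X'\<in>gr_words (Suc a) k (N - Suc i).
         c (map (sub a (w @ a # X)) R) = c (map (sub a (w @ a # X')) R)"
    using fusion[OF assms(2), of r N 0] unfolding add_0_right by blast
  show "\<exists>n. \<forall>c :: nat list \<Rightarrow> nat. (\<forall>w. c w < r) \<longrightarrow>
     (\<exists>R\<in>gr_words a m n. \<exists>\<gamma>. \<forall>E\<in>gr_words a (Suc k) m. c (map (sub a E) R) = \<gamma>)"
  proof (intro exI[of _ n] allI impI)
    fix c :: "nat list \<Rightarrow> nat" assume c: "\<forall>w. c w < r"
    then have r: "0 < r" by (metis gr_zeroI less_nat_zero_code)
    obtain Q where Q: "Q \<in> gr_words a N n"
      and Qc: "\<And>i w X X'. \<lbrakk>i < N; w \<in> const_words {..<a} i;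
          X \<in> gr_words (Suc a) k (N - Suc i); X' \<in> gr_words (Suc a) k (N - Suc i)\<rbrakk>
        \<Longrightarrow> c (map (sub a (w @ a # X)) Q) = c (map (sub a (w @ a # X')) Q)"
      using n[OF c] by blast
    \<comment> \<open>Any completion of the prefix will do, since the colour does not depend on the
      tail after composition with \<open>Q\<close>.\<close>
    define \<chi> where "\<chi> p = c (map (sub a (p @ a # (SOME X. X \<in> gr_words (Suc a) k (N - Suc (length p))))) Q)" for p
    obtain P where P: "P \<in> gr_words a M N" and "\<forall>s<M. \<exists>\<gamma>. \<forall>w\<in>const_words {..<a} s.
        \<chi> (map (sub a w) (takeWhile (\<lambda>x. x < a + s) P)) = \<gamma>"
      using N[of \<chi>] c by (auto simp: \<chi>_def)
    define f where "f s = \<chi> (map (sub a (replicate s 0)) (takeWhile (\<lambda>x. x < a + s) P))" for s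
    have f: "\<chi> (map (sub a w) (takeWhile (\<lambda>x. x < a + s) P)) = f s"
      if "s < M" "w \<in> const_words {..<a} s" for s w
    proof -
      have "replicate s 0 \<in> const_words {..<a} s" using a by (auto simp: const_words_def)
      with that \<open>\<forall>s<M. \<exists>\<gamma>. _ s \<gamma>\<close> show ?thesis unfolding f_def by metis
    qed
    have "f \<in> {..<M} \<rightarrow> {..<r}" using c by (simp add: f_def \<chi>_def)
    then obtain \<gamma> where "card {..<M} \<le> card (f -` {\<gamma>} \<inter> {..<M}) * card {..<r}"
      using pigeonhole_card[of f "{..<M}" "{..<r}"] r by auto
    then have "m \<le> card (f -` {\<gamma>} \<inter> {..<M})" using r by (simp add: M_def mult.commute)
    then obtain S where S: "S \<subseteq> f -` {\<gamma>} \<inter> {..<M}" "card S = m"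
      using obtain_subset_with_card_n by metis
    then obtain Z where Z: "Z \<in> gr_words a m M" "\<forall>i<M. i \<notin> S \<longrightarrow> Z ! i = 0"
      using gr_word_supported[OF a, of S M] by auto
    let ?PZ = "map (sub a Z) P"
    have PZ: "?PZ \<in> gr_words a m N" by (rule gr_words_sub[OF P Z(1)])
    show "\<exists>R\<in>gr_words a m n. \<exists>\<gamma>. \<forall>E\<in>gr_words a (Suc k) m. c (map (sub a E) R) = \<gamma>"
    proof (intro bexI[of _ "map (sub a ?PZ) Q"] exI[of _ \<gamma>] ballI)
      show "map (sub a ?PZ) Q \<in> gr_words a m n" by (rule gr_words_sub[OF Q PZ])
      fix E assume E: "E \<in> gr_words a (Suc k) m"
      obtain v y where vy: "map (sub a E) Z = v @ a # y" "v \<in> const_words {..<a} (length v)"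
        "length v < M" using gr_words_split[OF gr_words_sub[OF Z(1) E]] by metis
      \<comment> \<open>Outside \<open>S\<close> the word shows \<open>0\<close>, which differs from
        \<open>a\<close>, so its first \<open>a\<close> lies in \<open>S\<close>.\<close>
      have "length v \<in> S"
      proof (rule ccontr)
        assume "length v \<notin> S"
        then have "Z ! length v = 0" using Z vy by simp
        moreover have "map (sub a E) Z ! length v = sub a E (Z ! length v)"
          using vy Z by (intro nth_map) (simp add: gr_words_def)
        ultimately show False using vy(1) a by (simp add: sub_def)
      qed
      then have fv: "f (length v) = \<gamma>" using S by auto
      define T where "T = takeWhile (\<lambda>x. x < a + length v) P"
      obtain U where U: "P = T @ (a + length v) # U" and T: "rgs a (a + length v) T"
        using rgs_split[of a "a + M" P "a + length v"] P vy by (auto simp: gr_words_def T_def)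
      let ?p = "map (sub a v) T"
      have "map (sub a (v @ a # y)) T = ?p" by (rule map_sub_prefix[OF rgs_set[OF T]])
      then have eq: "map (sub a (v @ a # y)) P = ?p @ a # map (sub a (v @ a # y)) U"
        by (subst U) (simp add: sub_def)
      have "rgs a a v" using vy by (simp add: const_words_def rgs_const)
      then have "rgs a a ?p" using rgs_sub[OF T] by simp
      then have p: "?p \<in> const_words {..<a} (length ?p)" by (simp add: const_words_def rgs_const)
      have mem: "map (sub a (v @ a # y)) P \<in> gr_words a (Suc k) N"
        using gr_words_sub[OF P] gr_words_sub[OF Z(1) E] vy(1) by metis
      then have Y: "map (sub a (v @ a # y)) U \<in> gr_words (Suc a) k (N - Suc (length ?p))"
        using gr_words_tail[OF _ p] eq by metis
      then have "(SOME X. X \<in> gr_words (Suc a) k (N - Suc (length ?p)))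
          \<in> gr_words (Suc a) k (N - Suc (length ?p))" by (rule someI)
      moreover have "length ?p < N"
        using mem eq by (auto simp: gr_words_def dest!: arg_cong[of _ _ length])
      ultimately have "c (map (sub a (map (sub a (v @ a # y)) P)) Q) = \<chi> ?p"
        unfolding eq \<chi>_def using Qc[OF _ p Y] by blast
      moreover have "map (sub a E) (map (sub a ?PZ) Q) = map (sub a (map (sub a (v @ a # y)) P)) Q"
        by (simp only: gr_words_sub_assoc[OF Q PZ] gr_words_sub_assoc[OF P Z(1)] vy(1))
      moreover have "\<chi> ?p = \<gamma>" using f[OF vy(3,2)] fv by (simp add: T_def)
      ultimately show "c (map (sub a E) (map (sub a ?PZ) Q)) = \<gamma>" by (simp only:)
    qed
  qed
qed

theorem graham_rothschild: "0 < a \<Longrightarrow> GR a k"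
  by (induction k arbitrary: a) (auto intro: GR_0 GR_Suc)

text \<open>A nonempty word without constants begins with \<open>0\<close>. Deleting this letter
  leaves a word in which \<open>0\<close> is a constant, which is the case
  \<open>a = 1\<close>.\<close>

theorem dual_ramsey:
  "\<exists>n. \<forall>c :: nat list \<Rightarrow> nat. (\<forall>w. c w < r) \<longrightarrow>
     (\<exists>R\<in>gr_words 0 (Suc m) n. \<exists>\<gamma>. \<forall>E\<in>gr_words 0 (Suc k) (Suc m). c (map ((!) E) R) = \<gamma>)"
proof -
  obtain n where n: "\<And>c :: nat list \<Rightarrow> nat. (\<forall>w. c w < r) \<Longrightarrow>
     \<exists>R\<in>gr_words 1 m n. \<exists>\<gamma>. \<forall>E\<in>gr_words 1 k m. c (map (sub 1 E) R) = \<gamma>"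
  proof -
    have "GR 1 k" by (rule graham_rothschild) simp
    then show thesis using that unfolding GR_def by blast
  qed
  show ?thesis
  proof (intro exI[of _ "Suc n"] allI impI)
    fix c :: "nat list \<Rightarrow> nat" assume "\<forall>w. c w < r"
    then obtain R \<gamma> where R: "R \<in> gr_words 1 m n"
      and \<gamma>: "\<And>E. E \<in> gr_words 1 k m \<Longrightarrow> c (0 # map (sub 1 E) R) = \<gamma>"
      using n[of "\<lambda>w. c (0 # w)"] by auto
    show "\<exists>R\<in>gr_words 0 (Suc m) (Suc n). \<exists>\<gamma>. \<forall>E\<in>gr_words 0 (Suc k) (Suc m).
        c (map ((!) E) R) = \<gamma>"
    proof (intro bexI[of _ "0 # R"] exI[of _ \<gamma>] ballI)
      show "0 # R \<in> gr_words 0 (Suc m) (Suc n)" using R by (simp add: gr_words_def)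
      fix E assume "E \<in> gr_words 0 (Suc k) (Suc m)"
      then obtain D where D: "E = 0 # D" "D \<in> gr_words 1 k m"
        by (cases E) (auto simp: gr_words_def)
      have "map ((!) E) (0 # R) = 0 # map (sub 1 D) R"
        by (auto simp: D sub_def nth_Cons')
      then show "c (map ((!) E) (0 # R)) = \<gamma>" using \<gamma>[OF D(2)] by (simp only:)
    qed
  qed
qed

subsection \<open>Base-\<open>q\<close> numbering of vectors\<close>

lemma ex_digit:
  "\<exists>d :: 'a::{field,finite} \<Rightarrow> nat. bij_betw d UNIV {..<card (UNIV :: 'a set)} \<and> d 0 = 0 \<and> d 1 = 1"
proof -
  let ?q = "card (UNIV :: 'a set)"
  have q: "2 \<le> ?q" using card_mono[of UNIV "{0, 1 :: 'a}"] by simp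
  have "card (UNIV - {0, 1 :: 'a}) = card {2..<?q}" by (simp add: card_Diff_subset)
  then obtain f where f: "bij_betw f (UNIV - {0, 1 :: 'a}) {2..<?q}"
    using finite_same_card_bij[of "UNIV - {0, 1 :: 'a}" "{2..<?q}"] by auto
  define d where "d x = (if x = 0 then 0 else if x = 1 then 1 else f x)" for x
  have "bij_betw d (UNIV - {0, 1}) {2..<?q}"
    using f by (rule bij_betw_cong[THEN iffD1, rotated]) (auto simp: d_def)
  moreover have "bij_betw d {0, 1} {0, 1}" by (auto simp: bij_betw_def d_def)
  moreover have "{2..<?q} \<inter> {0, 1} = {}" by auto
  ultimately have "bij_betw d ((UNIV - {0, 1}) \<union> {0, 1}) ({2..<?q} \<union> {0, 1})"
    by (rule bij_betw_combine)
  moreover have "{2..<?q} \<union> {0, 1} = {..<?q}" "(UNIV - {0, 1}) \<union> {0, 1} = (UNIV :: 'a set)"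
    using q by auto
  ultimately have "bij_betw d UNIV {..<?q}" by (simp only:)
  then show ?thesis by (intro exI[of _ d]) (simp add: d_def)
qed

text \<open>Normalised so that the unit vector \<open>u\<^sub>j\<close> gets the number \<open>q ^ j\<close>.\<close>

definition digit :: "'a::{field,finite} \<Rightarrow> nat" where
  "digit = (SOME d. bij_betw d UNIV {..<card (UNIV :: 'a set)} \<and> d 0 = 0 \<and> d 1 = 1)"

lemma digit: "bij_betw (digit :: 'a::{field,finite} \<Rightarrow> nat) UNIV {..<card (UNIV :: 'a set)}"
  and digit_0 [simp]: "digit (0 :: 'a) = 0"
  and digit_1 [simp]: "digit (1 :: 'a) = 1"
  using someI_ex[OF ex_digit[where 'a='a]] unfolding digit_def by auto

lemma digit_less: "digit (x :: 'a::{field,finite}) < card (UNIV :: 'a set)"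
  using bij_betwE[OF digit] by auto

definition undigit :: "nat \<Rightarrow> 'a::{field,finite}" where
  "undigit = inv_into UNIV digit"

lemma undigit_digit [simp]: "undigit (digit x) = (x :: 'a::{field,finite})"
  using digit[where 'a='a] unfolding undigit_def by (auto simp: bij_betw_def)

lemma digit_undigit: "y < card (UNIV :: 'a set) \<Longrightarrow> digit (undigit y :: 'a::{field,finite}) = y"
  using digit[where 'a='a] unfolding undigit_def by (intro f_inv_into_f) (auto simp: bij_betw_def)

text \<open>Later coordinates are more significant, so the vectors supported on the first
  \<open>l\<close> coordinates are those with number below \<open>q ^ l\<close>.\<close>

definition number :: "nat \<Rightarrow> (nat \<Rightarrow> 'a::{field,finite}) \<Rightarrow> nat" where
  "number k v = (\<Sum>j<k. digit (v j) * card (UNIV :: 'a set) ^ j)"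

definition coord :: "nat \<Rightarrow> nat \<Rightarrow> 'a::{field,finite}" where
  "coord i j = undigit (i div card (UNIV :: 'a set) ^ j mod card (UNIV :: 'a set))"

lemma number_Suc:
  "number (Suc k) (v :: nat \<Rightarrow> 'a::{field,finite}) =
     number k v + digit (v k) * card (UNIV :: 'a set) ^ k"
  by (simp add: number_def)

lemma number_less: "number k (v :: nat \<Rightarrow> 'a::{field,finite}) < card (UNIV :: 'a set) ^ k"
proof (induction k)
  case (Suc k)
  let ?q = "card (UNIV :: 'a set)"
  have "Suc (digit (v k)) * ?q ^ k \<le> ?q * ?q ^ k"
    using digit_less[of "v k"] by (intro mult_right_mono) auto
  then show ?case using Suc by (simp add: number_Suc)
qed (simp add: number_def)

lemma number_support:
  "\<lbrakk>l \<le> k; \<And>j. \<lbrakk>l \<le> j; j < k\<rbrakk> \<Longrightarrow> v j = 0\<rbrakk> \<Longrightarrow> number k v = number l v"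
  unfolding number_def by (rule sum.mono_neutral_right) auto

lemma digit_coord:
  "digit (coord i j :: 'a::{field,finite}) = i div card (UNIV :: 'a set) ^ j mod card (UNIV :: 'a set)"
  unfolding coord_def by (rule digit_undigit) (simp add: finite_UNIV_card_ge_0)

lemma coord_number: "j < k \<Longrightarrow> coord (number k v) j = v j"
proof (induction k)
  case (Suc k)
  let ?q = "card (UNIV :: 'a set)"
  have q: "0 < ?q" by (simp add: finite_UNIV_card_ge_0)
  show ?case
  proof (cases "j = k")
    case True
    then have "number (Suc k) v div ?q ^ j = digit (v k)"
      using q number_less[of k v] by (simp add: number_Suc)
    then show ?thesis using True digit_less[of "v k"] by (simp add: coord_def)
  next
    case False
    then have j: "j < k" using Suc.prems by simp
    then obtain e where e: "k = j + Suc e" using less_iff_Suc_add by auto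
    have "number (Suc k) v = number k v + digit (v k) * ?q ^ Suc e * ?q ^ j"
      unfolding number_Suc using e by (simp add: power_add mult_ac)
    then have "number (Suc k) v div ?q ^ j = digit (v k) * ?q ^ Suc e + number k v div ?q ^ j"
      using q by simp
    also have "\<dots> mod ?q = number k v div ?q ^ j mod ?q"
      by (simp add: mult.left_commute[of _ ?q])
    finally show ?thesis using Suc.IH[OF j] by (simp add: coord_def)
  qed
qed simp

lemma number_coord_mod:
  "number k (coord i :: nat \<Rightarrow> 'a::{field,finite}) = i mod card (UNIV :: 'a set) ^ k"
proof (induction k)
  case (Suc k)
  let ?q = "card (UNIV :: 'a set)"
  have "i mod ?q ^ Suc k = ?q ^ k * (i div ?q ^ k mod ?q) + i mod ?q ^ k"
    unfolding power_Suc2 by (rule mod_mult2_eq)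
  then show ?case by (simp add: number_Suc digit_coord Suc)
qed (simp add: number_def)

lemma coord_small: "i < card (UNIV :: 'a set) ^ j \<Longrightarrow> (coord i j :: 'a::{field,finite}) = 0"
  using undigit_digit[of "0 :: 'a"] by (simp add: coord_def)

lemma coord_power: "(coord (card (UNIV :: 'a set) ^ j) l :: 'a::{field,finite}) = (if l = j then 1 else 0)"
proof -
  let ?u = "\<lambda>l. if l = j then 1 else (0 :: 'a)" and ?k = "Suc (max j l)"
  have "number ?k ?u = (\<Sum>i<?k. if i = j then card (UNIV :: 'a set) ^ i else 0)"
    unfolding number_def by (rule sum.cong) auto
  also have "\<dots> = card (UNIV :: 'a set) ^ j" by (simp add: sum.delta)
  finally show ?thesis using coord_number[of l ?k ?u] by simp
qed

lemma coord_block: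
  assumes "x < card (UNIV :: 'a set)" "i < card (UNIV :: 'a set) ^ t" "s \<le> t"
  shows "(coord (x * card (UNIV :: 'a set) ^ t + i) s :: 'a::{field,finite}) =
    (if s = t then undigit x else coord i s)"
proof -
  let ?q = "card (UNIV :: 'a set)"
  define v where "v s = (if s = t then undigit x else coord i s :: 'a)" for s
  have "number t v = number t (coord i :: nat \<Rightarrow> 'a)"
    unfolding number_def v_def by (rule sum.cong) auto
  then have "number (Suc t) v = x * ?q ^ t + i"
    using assms by (simp add: number_Suc number_coord_mod digit_undigit v_def)
  then show ?thesis using coord_number[of s "Suc t" v] assms(3) by (simp add: v_def)
qed

subsection \<open>Echelon matrices as restricted growth words\<close>

text \<open>Row vector number \<open>i\<close> times the first \<open>t\<close> rows of
  \<open>E\<close>; the count \<open>t\<close> is explicit for an induction that adds rows one by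
  one.\<close>

definition comb :: "nat \<Rightarrow> (nat \<Rightarrow> nat \<Rightarrow> 'a::{field,finite}) \<Rightarrow> nat \<Rightarrow> nat \<Rightarrow> 'a" where
  "comb t E i j = (\<Sum>s<t. coord i s * E s j)"

text \<open>The linear map \<open>v \<mapsto> v E\<close> on row vectors, read through the numbering.\<close>

definition table :: "nat \<Rightarrow> nat \<Rightarrow> (nat \<Rightarrow> nat \<Rightarrow> 'a::{field,finite}) \<Rightarrow> nat list" where
  "table k t E = map (\<lambda>i. number k (comb t E i)) [0..<card (UNIV :: 'a set) ^ t]"

lemma rgs_plus: "rgs a b w \<Longrightarrow> rgs (a + c) (b + c) (map (\<lambda>x. x + c) w)"
  by (induction a b w rule: rgs.induct) auto

text \<open>Here \<kappa> counts the pivots among the first \<open>t\<close> rows. If row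
  \<open>t\<close> is the pivot row of column \<open>j\<close>, it is a unit vector, and the
  enlarged table consists of \<open>q\<close> copies of the old one, shifted by multiples of
  \<open>q ^ j\<close>. Otherwise row \<open>t\<close> is supported on the first \<kappa>
  coordinates, and all added entries are old letters below \<open>q ^ \<kappa>\<close>.\<close>

lemma rgs_table:
  fixes E :: "nat \<Rightarrow> nat \<Rightarrow> 'a::{field,finite}"
  assumes unit: "\<And>j l. \<lbrakk>j < k; l < k\<rbrakk> \<Longrightarrow> E (p j) l = (if l = j then 1 else 0)"
    and above: "\<And>s j. \<lbrakk>j < k; s < p j\<rbrakk> \<Longrightarrow> E s j = 0"
    and mono: "\<And>j l. \<lbrakk>j < l; l < k\<rbrakk> \<Longrightarrow> p j < p l"
    and "\<kappa> \<le> k" "\<And>j. j < \<kappa> \<Longrightarrow> p j < t" "\<And>j. \<lbrakk>\<kappa> \<le> j; j < k\<rbrakk> \<Longrightarrow> t \<le> p j"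
  shows "rgs 0 (card (UNIV :: 'a set) ^ \<kappa>) (table k t E)"
  using assms(4-6)
proof (induction t arbitrary: \<kappa>)
  case 0
  have "number k (comb 0 E 0) = 0" by (simp add: number_def comb_def)
  then show ?case using 0 by (cases \<kappa>) (auto simp: table_def)
next
  case (Suc t)
  let ?q = "card (UNIV :: 'a set)"
  let ?f = "\<lambda>i. number k (comb (Suc t) E i)"
  show ?case
  proof (cases "\<exists>j. \<kappa> = Suc j \<and> p j = t")
    case True
    then obtain j where j: "\<kappa> = Suc j" "p j = t" "j < k" using Suc.prems(1) by auto
    have IH: "rgs 0 (?q ^ j) (table k t E)"
    proof (rule Suc.IH)
      show "p l < t" if "l < j" for l using mono[OF that] j by simp
      show "t \<le> p l" if "j \<le> l" "l < k" for l
        using mono[of j l] that j by (cases "l = j") auto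
    qed (use j in simp)
    have zero: "comb t E i l = 0" if "j \<le> l" "l < k" for i l
      unfolding comb_def
    proof (rule sum.neutral, rule ballI)
      fix s assume "s \<in> {..<t}"
      then have "s < p l" using mono[of j l] that j by (cases "l = j") auto
      then show "coord i s * E s l = 0" using above that by simp
    qed
    have f: "?f (x * ?q ^ t + i) = number k (comb t E i) + x * ?q ^ j"
      if x: "x < ?q" and i: "i < ?q ^ t" for x i
    proof -
      have comb: "comb (Suc t) E (x * ?q ^ t + i) l =
          comb t E i l + (if l = j then undigit x else 0)" if "l < k" for l
        using coord_block[OF x i, of t] coord_block[OF x i] unit[OF j(3) that] j(2)
        by (simp add: comb_def)
      have "?f (x * ?q ^ t + i) = number (Suc j) (comb (Suc t) E (x * ?q ^ t + i))"
        using j(3) zero by (intro number_support) (auto simp: comb)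
      also have "\<dots> = number j (comb (Suc t) E (x * ?q ^ t + i)) + x * ?q ^ j"
        using zero[of j i] j(3) x by (simp add: number_Suc comb digit_undigit)
      also have "number j (comb (Suc t) E (x * ?q ^ t + i)) = number j (comb t E i)"
        unfolding number_def using j(3) by (intro sum.cong) (auto simp: comb)
      also have "\<dots> = number k (comb t E i)"
        using j(3) zero by (intro number_support[symmetric]) auto
      finally show ?thesis .
    qed
    have "rgs 0 (x * ?q ^ j) (map ?f [0..<x * ?q ^ t])" if "x \<le> ?q" for x
      using that
    proof (induction x)
      case (Suc x)
      have "[0..<Suc x * ?q ^ t] = [0..<x * ?q ^ t] @ [x * ?q ^ t..<x * ?q ^ t + ?q ^ t]"
        using upt_add_eq_append[of 0 "x * ?q ^ t" "?q ^ t"] by (simp add: add.commute)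
      also have "[x * ?q ^ t..<x * ?q ^ t + ?q ^ t] = map (\<lambda>i. x * ?q ^ t + i) [0..<?q ^ t]"
        using map_add_upt[of "x * ?q ^ t" "?q ^ t"] by (simp add: add.commute)
      finally have "map ?f [0..<Suc x * ?q ^ t] =
          map ?f [0..<x * ?q ^ t] @ map (\<lambda>y. y + x * ?q ^ j) (table k t E)"
        using Suc.prems f by (simp add: table_def)
      moreover have "rgs (x * ?q ^ j) (Suc x * ?q ^ j) (map (\<lambda>y. y + x * ?q ^ j) (table k t E))"
        using rgs_plus[OF IH, of "x * ?q ^ j"] by simp
      ultimately show ?case using Suc by (simp only: rgs_append) auto
    qed simp
    from this[of ?q] show ?thesis by (simp add: table_def j(1))
  next
    case False
    have "p l < t" if l: "l < \<kappa>" for l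
    proof -
      obtain j where j: "\<kappa> = Suc j" using l by (cases \<kappa>) auto
      then have "p j < t" using False Suc.prems(2)[of j] by auto
      then show ?thesis using mono[of l j] l j Suc.prems(1) by (cases "l = j") auto
    qed
    then have IH: "rgs 0 (?q ^ \<kappa>) (table k t E)"
      using Suc.prems by (intro Suc.IH) (auto dest: Suc_leD)
    have "?f i < ?q ^ \<kappa>" for i
    proof -
      have "comb (Suc t) E i l = 0" if "\<kappa> \<le> l" "l < k" for l
        unfolding comb_def using above[OF that(2)] Suc.prems(3)[OF that]
        by (intro sum.neutral) auto
      then have "?f i = number \<kappa> (comb (Suc t) E i)"
        using Suc.prems(1) by (intro number_support) auto
      then show ?thesis using number_less by simp
    qed
    then have "rgs (?q ^ \<kappa>) (?q ^ \<kappa>) (map ?f [?q ^ t..<?q ^ Suc t])"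
      by (auto simp: rgs_const)
    moreover have "map ?f [0..<?q ^ t] = table k t E"
    proof -
      have "comb (Suc t) E i = comb t E i" if "i < ?q ^ t" for i
        using coord_small[where 'a='a, OF that] by (auto simp: comb_def)
      then show ?thesis unfolding table_def by simp
    qed
    moreover have "[0..<?q ^ Suc t] = [0..<?q ^ t] @ [?q ^ t..<?q ^ Suc t]"
      using upt_add_eq_append[of 0 "?q ^ t" "?q ^ Suc t - ?q ^ t"]
        power_increasing[of t "Suc t" ?q] finite_UNIV_card_ge_0[where 'a='a] by (simp del: power_Suc)
    ultimately have "table k (Suc t) E = table k t E @ map ?f [?q ^ t..<?q ^ Suc t]"
      by (metis map_append table_def)
    with IH \<open>rgs (?q ^ \<kappa>) (?q ^ \<kappa>) _\<close> show ?thesis by (auto simp only: rgs_append)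
  qed
qed

text \<open>Explicit column echelon form, \<open>p j\<close> being the leading row of column
  \<open>j\<close>. A pivot in every column amounts to full column rank.\<close>

definition pivots :: "nat \<Rightarrow> nat \<Rightarrow> 'a::{zero,one} mat \<Rightarrow> (nat \<Rightarrow> nat) \<Rightarrow> bool" where
  "pivots n k B p \<longleftrightarrow> (\<forall>j<k. p j < n \<and> (\<forall>i<p j. B $$ (i, j) = 0) \<and>
     (\<forall>l<k. B $$ (p j, l) = (if l = j then 1 else 0))) \<and> (\<forall>l<k. \<forall>j<l. p j < p l)"

abbreviation mat_table :: "nat \<Rightarrow> nat \<Rightarrow> 'a::{field,finite} mat \<Rightarrow> nat list" where
  "mat_table k m E \<equiv> table k m (\<lambda>s j. E $$ (s, j))"

text \<open>A word is read as a list of rows, whereas \<open>mat_table\<close> lists the values of a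
  linear map; looking up row numbers in such a table multiplies the matrices.\<close>

definition word_mat :: "nat \<Rightarrow> nat \<Rightarrow> nat list \<Rightarrow> 'a::{field,finite} mat" where
  "word_mat n k w = mat n k (\<lambda>(i, j). coord (w ! i) j)"

lemma word_mat_carrier [simp]: "word_mat n k w \<in> carrier_mat n k"
  by (simp add: word_mat_def)

lemma mat_table_in_gr_words:
  fixes E :: "'a::{field,finite} mat"
  assumes "pivots m k E p"
  shows "mat_table k m E \<in> gr_words 0 (card (UNIV :: 'a set) ^ k) (card (UNIV :: 'a set) ^ m)"
proof -
  have "rgs 0 (card (UNIV :: 'a set) ^ k) (mat_table k m E)"
    using assms unfolding pivots_def by (intro rgs_table[of k _ p]) auto
  then show ?thesis by (simp add: gr_words_def table_def)
qed

text \<open>The first \<open>q ^ j\<close> in \<open>R\<close> is the row that is unit vector number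
  \<open>j\<close>; all earlier letters are smaller, so coordinate \<open>j\<close> of those rows
  vanishes.\<close>

lemma pivots_word_mat:
  assumes "R \<in> gr_words 0 (card (UNIV :: 'a set) ^ m) n"
  shows "\<exists>p. pivots n m (word_mat n m R :: 'a::{field,finite} mat) p"
proof -
  let ?q = "card (UNIV :: 'a set)"
  have q: "1 < ?q" using card_mono[of UNIV "{0, 1 :: 'a}"] by simp
  define p where "p j = length (takeWhile (\<lambda>x. x < ?q ^ j) R)" for j
  have p: "p j < n" "R ! p j = ?q ^ j" "\<And>i. i < p j \<Longrightarrow> R ! i < ?q ^ j" if "j < m" for j
  proof -
    have "?q ^ j < ?q ^ m" using that q by simp
    then obtain V where V: "R = takeWhile (\<lambda>x. x < ?q ^ j) R @ ?q ^ j # V"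
      using rgs_split[of 0 "?q ^ m" R "?q ^ j"] assms by (auto simp: gr_words_def)
    show "p j < n" using arg_cong[OF V, of length] assms by (simp add: p_def gr_words_def)
    show "R ! p j = ?q ^ j" by (subst V) (simp add: p_def nth_append)
    fix i assume i: "i < p j"
    then have "takeWhile (\<lambda>x. x < ?q ^ j) R ! i \<in> set (takeWhile (\<lambda>x. x < ?q ^ j) R)"
      unfolding p_def by (rule nth_mem)
    then show "R ! i < ?q ^ j"
      using i unfolding p_def by (auto simp: takeWhile_nth dest: set_takeWhileD)
  qed
  have "p j < p l" if "j < l" "l < m" for j l
  proof (rule ccontr)
    assume "\<not> p j < p l"
    moreover have "?q ^ j < ?q ^ l" using that q by simp
    ultimately show False using p[of j] p[of l] that by (metis less_trans linorder_neqE_nat order.asym)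
  qed
  moreover have "(word_mat n m R :: 'a mat) $$ (i, j) = 0" if "j < m" "i < p j" for i j
    using that p(1)[of j] p(3)[of j i] by (simp add: word_mat_def coord_small)
  moreover have "(word_mat n m R :: 'a mat) $$ (p j, l) = (if l = j then 1 else 0)"
    if "j < m" "l < m" for j l
    using that p(1,2)[of j] by (simp add: word_mat_def coord_power)
  ultimately have "pivots n m (word_mat n m R :: 'a mat) p"
    unfolding pivots_def using p(1) by blast
  then show ?thesis by blast
qed

lemma word_mat_table:
  assumes "R \<in> gr_words 0 (card (UNIV :: 'a set) ^ m) n" "E \<in> carrier_mat m k"
  shows "word_mat n k (map ((!) (mat_table k m E)) R) = word_mat n m R * (E :: 'a::{field,finite} mat)"
proof (rule eq_matI)
  fix i j assume ij: "i < dim_row (word_mat n m R * E)" "j < dim_col (word_mat n m R * E)"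
  then have i: "i < n" and j: "j < k" using assms by (auto simp: word_mat_def)
  then have "R ! i < card (UNIV :: 'a set) ^ m"
    using gr_words_set[OF assms(1)] assms(1) by (auto simp: gr_words_def dest!: nth_mem)
  then have "(word_mat n k (map ((!) (mat_table k m E)) R)) $$ (i, j) =
      comb m (\<lambda>s j. E $$ (s, j)) (R ! i) j"
    using i j assms by (simp add: word_mat_def table_def coord_number gr_words_def)
  also have "\<dots> = (word_mat n m R * E) $$ (i, j)"
    using i j assms by (simp add: word_mat_def comb_def scalar_prod_def atLeast0LessThan)
  finally show "(word_mat n k (map ((!) (mat_table k m E)) R)) $$ (i, j) =
      (word_mat n m R * E) $$ (i, j)" .
qed (use assms in \<open>auto simp: word_mat_def\<close>)

subsection \<open>Column echelon forms\<close>

lemma mat_mult_unit_vec: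
  "\<lbrakk>A \<in> carrier_mat n k; j < k\<rbrakk> \<Longrightarrow> A *\<^sub>v unit_vec k j = col (A :: 'a::field mat) j"
  by (intro eq_vecI) (auto simp: scalar_prod_right_unit)

text \<open>Independence of the set of columns does not see repetitions, so both directions first
  show the columns distinct: by counting, or because equal columns would put a difference of unit
  vectors into the kernel.\<close>

lemma mat_rank_eq_iff:
  fixes A :: "'a::field mat"
  assumes A: "A \<in> carrier_mat n k"
  shows "mat_rank A = k \<longleftrightarrow> (\<forall>v\<in>carrier_vec k. A *\<^sub>v v = 0\<^sub>v n \<longrightarrow> v = 0\<^sub>v k)"
proof -
  interpret vec_space "TYPE('a)" n .
  have rank: "mat_rank A = rank A" using A by (simp add: mat_rank_def)
  have dist_rank: "distinct (cols A)" if full: "rank A = k"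
  proof (rule ccontr)
    assume nd: "\<not> distinct (cols A)"
    obtain S where S: "maximal S (\<lambda>T. T \<subseteq> set (cols A) \<and> lin_indpt T)"
      using maximal_exists[of "(\<lambda>T. T \<subseteq> set (cols A) \<and> lin_indpt T)" "card (set (cols A))" "{}"]
      by (meson List.finite_set card_mono empty_iff empty_subsetI finite_lin_indpt2 rev_finite_subset)
    then have "card S \<le> card (set (cols A))" by (simp add: card_mono maximal_def)
    moreover have "card (set (cols A)) < k"
      using nd A card_length[of "cols A"] card_distinct[of "cols A"] by fastforce
    ultimately show False using rank_card_indpt[OF A S] full by simp
  qed
  have dist_ker: "distinct (cols A)"
    if ker: "\<forall>v\<in>carrier_vec k. A *\<^sub>v v = 0\<^sub>v n \<longrightarrow> v = 0\<^sub>v k"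
  proof (rule ccontr)
    assume "\<not> distinct (cols A)"
    then obtain i j where ij: "i < k" "j < k" "i \<noteq> j" "col A i = col A j"
      using A unfolding distinct_conv_nth by auto
    let ?v = "unit_vec k i - unit_vec k j :: 'a vec"
    have "A *\<^sub>v ?v = A *\<^sub>v unit_vec k i - A *\<^sub>v unit_vec k j"
      using A by (intro mult_minus_distrib_mat_vec) auto
    also have "\<dots> = 0\<^sub>v n" using ij col_carrier_vec[of j k A n] A by (simp add: mat_mult_unit_vec[OF A])
    finally have "?v = 0\<^sub>v k" using ker by simp
    then have "?v $ i = 0" using ij by simp
    then show False using ij by simp
  qed
  show ?thesis
  proof
    assume "mat_rank A = k"
    then have full: "rank A = k" using rank by simp
    then show "\<forall>v\<in>carrier_vec k. A *\<^sub>v v = 0\<^sub>v n \<longrightarrow> v = 0\<^sub>v k"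
      using lin_depI[OF A] dist_rank full_rank_lin_indpt[OF A] by blast
  next
    assume ker: "\<forall>v\<in>carrier_vec k. A *\<^sub>v v = 0\<^sub>v n \<longrightarrow> v = 0\<^sub>v k"
    then have "lin_indpt (set (cols A))"
      using lin_depE[OF A _ dist_ker[OF ker]] by blast
    then show "mat_rank A = k" using lin_indpt_full_rank[OF A dist_ker[OF ker]] rank by simp
  qed
qed

text \<open>The pivot rows of \<open>B\<close> form the identity matrix.\<close>

lemma mult_at_pivot:
  fixes B :: "'a::field mat"
  assumes "pivots n k B p" "B \<in> carrier_mat n k" "W \<in> carrier_mat k r" "i < k" "j < r"
  shows "(B * W) $$ (p i, j) = W $$ (i, j)"
proof -
  have "(B * W) $$ (p i, j) = (\<Sum>l<k. B $$ (p i, l) * W $$ (l, j))"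
    using assms by (simp add: pivots_def scalar_prod_def atLeast0LessThan)
  also have "\<dots> = (\<Sum>l<k. if l = i then W $$ (l, j) else 0)"
    using assms by (intro sum.cong) (auto simp: pivots_def)
  also have "\<dots> = W $$ (i, j)" using assms by simp
  finally show ?thesis .
qed

lemma pivots_rank:
  fixes B :: "'a::field mat"
  assumes p: "pivots n k B p" and B: "B \<in> carrier_mat n k"
  shows "mat_rank B = k"
  unfolding mat_rank_eq_iff[OF B]
proof (intro ballI impI)
  fix v :: "'a vec" assume v: "v \<in> carrier_vec k" "B *\<^sub>v v = 0\<^sub>v n"
  show "v = 0\<^sub>v k"
  proof (rule eq_vecI)
    fix j assume j: "j < dim_vec (0\<^sub>v k :: 'a vec)"
    have "(B *\<^sub>v v) $ p j = (\<Sum>l<k. B $$ (p j, l) * v $ l)"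
      using p B v(1) j by (simp add: pivots_def scalar_prod_def atLeast0LessThan)
    also have "\<dots> = (\<Sum>l<k. if l = j then v $ l else 0)"
      using p j by (intro sum.cong) (auto simp: pivots_def)
    also have "\<dots> = v $ j" using j by simp
    finally have "v $ j = (B *\<^sub>v v) $ p j" by (rule sym)
    then show "v $ j = (0\<^sub>v k :: 'a vec) $ j" using v p j by (simp add: pivots_def)
  qed (use v in simp)
qed

text \<open>A pivot function may take the value \<open>n\<close>, but only at a zero column of
  \<open>B\<close>. Full rank excludes this, and its monotonicity becomes strict.\<close>

lemma echelon_mats_iff_pivots:
  fixes B :: "'a::field mat"
  shows "B \<in> echelon_mats n k \<longleftrightarrow> B \<in> carrier_mat n k \<and> (\<exists>p. pivots n k B p)"
proof safe
  assume "B \<in> echelon_mats n k"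
  then have B: "B \<in> carrier_mat n k" and rank: "mat_rank B = k" and "col_echelon_form B"
    by (auto simp: echelon_mats_def rank_mats_def)
  then show "B \<in> carrier_mat n k" by simp
  obtain f where f: "pivot_fun (transpose_mat B) f n"
    using \<open>col_echelon_form B\<close> B by (auto simp: col_echelon_form_def row_echelon_form_def)
  have dim: "dim_row (transpose_mat B) = k" using B by simp
  note pf = pivot_funD[OF dim f]
  have less: "f j < n" if j: "j < k" for j
  proof (rule ccontr)
    assume "\<not> f j < n"
    then have "B $$ (i, j) = 0" if "i < n" for i using pf(2)[OF j, of i] j B that by simp
    then have "col B j = 0\<^sub>v n" using j B by (intro eq_vecI) auto
    then have "B *\<^sub>v unit_vec k j = 0\<^sub>v n" using j by (simp add: mat_mult_unit_vec[OF B])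
    then have "unit_vec k j = (0\<^sub>v k :: 'a vec)" using rank unfolding mat_rank_eq_iff[OF B] by simp
    then show False using j by (metis index_unit_vec(1) index_zero_vec(1) zero_neq_one)
  qed
  have mono: "f j < f l" if "j < l" "l < k" for j l
    using that
  proof (induction l)
    case (Suc l)
    have "f l < f (Suc l)" using pf(3)[of l] less[of "Suc l"] Suc.prems by auto
    then show ?case using Suc by (cases "j = l") auto
  qed simp
  have "pivots n k B f"
    unfolding pivots_def using less mono
  proof (intro conjI allI impI)
    fix j i assume "j < k" "i < f j"
    then show "B $$ (i, j) = 0" using pf(2)[of j i] less[of j] B by simp
  next
    fix j l assume "j < k" "l < k"
    then show "B $$ (f j, l) = (if l = j then 1 else 0)"
      using pf(4)[of j] pf(5)[of j l] less[of j] B by auto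
  qed auto
  then show "\<exists>p. pivots n k B p" by blast
next
  fix p assume B: "B \<in> carrier_mat n k" and p: "pivots n k B p"
  have "pivot_fun (transpose_mat B) p n"
    using p B by (intro pivot_funI[of _ k]) (auto simp: pivots_def less_imp_le)
  then show "B \<in> echelon_mats n k"
    using B pivots_rank[OF p B]
    by (auto simp: echelon_mats_def rank_mats_def col_echelon_form_def row_echelon_form_def)
qed

text \<open>The pivot rows are the leading positions of the vectors in the column space, so they are
  the same for \<open>B\<close> and \<open>B * W\<close>; the pivot rows of \<open>B * W\<close> then spell out \<open>W\<close>.\<close>

lemma echelon_mult_unique:
  fixes B :: "'a::field mat"
  assumes p: "pivots n k B p" and q: "pivots n k (B * W) q"
    and B: "B \<in> carrier_mat n k" and W: "W \<in> carrier_mat k k"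
  shows "W = 1\<^sub>m k"
proof -
  have entry: "(B * W) $$ (s, j) = (\<Sum>i<k. B $$ (s, i) * W $$ (i, j))" if "s < n" "j < k" for s j
    using that B W by (simp add: scalar_prod_def atLeast0LessThan)
  have "q j \<in> p ` {..<k}" if j: "j < k" for j
  proof -
    have one: "(B * W) $$ (q j, j) = 1" "q j < n" using q j by (auto simp: pivots_def)
    have "\<exists>i. i < k \<and> W $$ (i, j) \<noteq> 0"
    proof (rule ccontr)
      assume "\<not> ?thesis"
      then have "(B * W) $$ (q j, j) = 0" unfolding entry[OF one(2) j] by (intro sum.neutral) auto
      then show False using one by simp
    qed
    \<comment> \<open>For the least such \<open>i\<close>, column \<open>j\<close> of
      \<open>B * W\<close> has its first nonzero entry in row \<open>p i\<close>, so
      \<open>q j = p i\<close>.\<close>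
    then obtain i where i: "i < k" "W $$ (i, j) \<noteq> 0" "\<And>l. l < i \<Longrightarrow> \<not> (l < k \<and> W $$ (l, j) \<noteq> 0)"
      using exists_least_iff[of "\<lambda>i. i < k \<and> W $$ (i, j) \<noteq> 0"] by blast
    have "(B * W) $$ (p i, j) \<noteq> 0" using mult_at_pivot[OF p B W i(1) j] i(2) by simp
    moreover have "(B * W) $$ (p i, j) = 0" if "p i < q j" using that q j by (simp add: pivots_def)
    ultimately have "q j \<le> p i" using not_less by blast
    moreover have "(B * W) $$ (s, j) = 0" if s: "s < p i" for s
    proof -
      have "s < n" using s p i(1) by (auto simp: pivots_def)
      moreover have "B $$ (s, l) * W $$ (l, j) = 0" if "l < k" for l
      proof (cases "l < i")
        case False
        then have "p i \<le> p l" using p that by (cases "l = i") (auto simp: pivots_def less_imp_le)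
        then show ?thesis using p that s by (simp add: pivots_def)
      qed (use i(3) that in auto)
      ultimately show ?thesis unfolding entry[OF \<open>s < n\<close> j] by (intro sum.neutral) auto
    qed
    then have "p i \<le> q j" using one by (metis not_less zero_neq_one)
    ultimately show ?thesis using i(1) by auto
  qed
  then have sub: "q ` {..<k} \<subseteq> p ` {..<k}" by auto
  have mono: "sorted_wrt (<) (map f [0..<k])" if "pivots n k C f" for C :: "'a mat" and f
    using that by (simp add: sorted_wrt_iff_nth_less pivots_def)
  have inj: "inj_on f {..<k}" if "pivots n k C f" for C :: "'a mat" and f
    using that unfolding pivots_def inj_on_def by (metis lessThan_iff linorder_neqE_nat less_irrefl)
  have "q ` {..<k} = p ` {..<k}"
    using sub card_image[OF inj[OF p]] card_image[OF inj[OF q]] by (intro card_subset_eq) auto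
  then have "map q [0..<k] = map p [0..<k]"
    using mono[OF p] mono[OF q]
    by (intro strict_sorted_equal) (auto simp: atLeast0LessThan)
  then have qp: "q i = p i" if "i < k" for i using that by simp
  show ?thesis
  proof (rule eq_matI)
    fix i j assume "i < dim_row (1\<^sub>m k :: 'a mat)" "j < dim_col (1\<^sub>m k :: 'a mat)"
    then have ij: "i < k" "j < k" by auto
    have "W $$ (i, j) = (B * W) $$ (q i, j)" using mult_at_pivot[OF p B W ij] qp ij by simp
    also have "\<dots> = (1\<^sub>m k :: 'a mat) $$ (i, j)" using q ij by (simp add: pivots_def)
    finally show "W $$ (i, j) = (1\<^sub>m k :: 'a mat) $$ (i, j)" .
  qed (use W in auto)
qed

section \<open>Invertible matrices and the normalising factor \<open>tau\<close>\<close>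

lemma GL_matsD:
  assumes "T \<in> GL_mats k"
  obtains S where "S \<in> GL_mats k" "T * S = 1\<^sub>m k" "S * T = 1\<^sub>m k"
proof -
  obtain S where S: "T * S = 1\<^sub>m k" "S * T = 1\<^sub>m (dim_row S)"
    using assms by (auto simp: GL_mats_def invertible_mat_def inverts_mat_def)
  have T: "T \<in> carrier_mat k k" using assms by (simp add: GL_mats_def)
  have "S \<in> carrier_mat k k"
    using arg_cong[OF S(1), of dim_col] arg_cong[OF S(2), of dim_col] T by (intro carrier_matI) auto
  with S T show thesis
    by (intro that[of S]) (auto simp: GL_mats_def invertible_mat_def inverts_mat_def)
qed

lemma GL_matsI:
  assumes "T \<in> carrier_mat k k" "S \<in> carrier_mat k k" "T * S = 1\<^sub>m k" "S * T = 1\<^sub>m k"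
  shows "T \<in> GL_mats k"
  using assms by (auto simp: GL_mats_def invertible_mat_def inverts_mat_def)

lemma finite_GL_mats: "finite (GL_mats k :: 'a::{field,finite} mat set)"
proof (rule finite_subset)
  let ?F = "{..<k} \<times> {..<k} \<rightarrow>\<^sub>E (UNIV :: 'a set)"
  show "GL_mats k \<subseteq> mat k k ` ?F"
  proof
    fix T :: "'a mat" assume "T \<in> GL_mats k"
    then have "T = mat k k (restrict (\<lambda>ij. T $$ ij) ({..<k} \<times> {..<k}))"
      by (intro eq_matI) (auto simp: GL_mats_def)
    moreover have "restrict (\<lambda>ij. T $$ ij) ({..<k} \<times> {..<k}) \<in> ?F" by auto
    ultimately show "T \<in> mat k k ` ?F" by blast
  qed
  show "finite (mat k k ` ?F)" by (intro finite_imageI finite_PiE) auto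
qed

lemma rank_mats_mult_GL:
  fixes A :: "'a::field mat"
  assumes A: "A \<in> rank_mats k n k" and T: "T \<in> GL_mats k"
  shows "A * T \<in> rank_mats k n k"
proof -
  obtain S where S: "S \<in> GL_mats k" "S * T = 1\<^sub>m k" using GL_matsD[OF T] by metis
  have car: "A \<in> carrier_mat n k" "T \<in> carrier_mat k k" "S \<in> carrier_mat k k"
    using A T S by (auto simp: rank_mats_def GL_mats_def)
  have AT: "A * T \<in> carrier_mat n k" using car by simp
  have "v = 0\<^sub>v k" if v: "v \<in> carrier_vec k" "(A * T) *\<^sub>v v = 0\<^sub>v n" for v
  proof -
    have "A *\<^sub>v (T *\<^sub>v v) = 0\<^sub>v n" using v car by (simp add: assoc_mult_mat_vec)
    then have "T *\<^sub>v v = 0\<^sub>v k"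
      using A car v mat_rank_eq_iff[OF car(1)] by (auto simp: rank_mats_def)
    then have "S *\<^sub>v (T *\<^sub>v v) = 0\<^sub>v k" using car by auto
    moreover have "S *\<^sub>v (T *\<^sub>v v) = (S * T) *\<^sub>v v"
      using v car by (intro assoc_mult_mat_vec[symmetric]) auto
    ultimately show ?thesis using v S(2) by simp
  qed
  then show ?thesis using AT mat_rank_eq_iff[OF AT] by (simp add: rank_mats_def)
qed

text \<open>If \<open>S\<close> inverts \<open>T\<close>, another candidate satisfies
  \<open>A * T' = (A * T) * (S * T')\<close>, and uniqueness of echelon forms forces
  \<open>S * T'\<close> to be the identity.\<close>

lemma tau_eqI:
  fixes A :: "'a::field mat"
  assumes A: "A \<in> rank_mats k n k" and T: "T \<in> GL_mats k" and AT: "col_echelon_form (A * T)"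
  shows "tau k A = T"
  unfolding tau_def
proof (rule the_equality)
  fix T' assume T': "T' \<in> GL_mats k \<and> col_echelon_form (A * T')"
  obtain S where S: "S \<in> GL_mats k" "T * S = 1\<^sub>m k" using GL_matsD[OF T] by metis
  have car: "A \<in> carrier_mat n k" "T \<in> carrier_mat k k" "S \<in> carrier_mat k k" "T' \<in> carrier_mat k k"
    using A T S T' by (auto simp: rank_mats_def GL_mats_def)
  have "(A * T) * (S * T') = A * ((T * S) * T')"
    using car by (simp add: assoc_mult_mat[of _ n k _ k _ k] assoc_mult_mat[of _ k k _ k _ k])
  then have eq: "(A * T) * (S * T') = A * T'" using car S(2) by simp
  have ech: "A * U \<in> echelon_mats n k" if "U \<in> GL_mats k" "col_echelon_form (A * U)" for U
    using rank_mats_mult_GL[OF A that(1)] that(2) by (simp add: echelon_mats_def)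
  obtain p q where pq: "pivots n k (A * T) p" "pivots n k ((A * T) * (S * T')) q"
    using ech[OF T AT] ech[of T'] T' unfolding echelon_mats_iff_pivots eq by blast
  have "S * T' = 1\<^sub>m k" using car by (intro echelon_mult_unique[OF pq]) auto
  then have "T * (S * T') = T" using car by simp
  moreover have "T * (S * T') = T'"
    using car S(2) by (simp add: assoc_mult_mat[of _ k k _ k _ k, symmetric])
  ultimately show "T' = T" by simp
qed (use T AT in simp)

text \<open>Gauss-Jordan elimination multiplies the transpose by an invertible \<open>P\<close> on
  the left; transposing back gives \<open>transpose_mat P\<close> as a right factor.\<close>

lemma ex_col_echelon_form:
  fixes A :: "'a::field mat"
  assumes "A \<in> carrier_mat n k"
  shows "\<exists>T\<in>GL_mats k. col_echelon_form (A * T)"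
proof -
  have At: "transpose_mat A \<in> carrier_mat k n" using assms by simp
  obtain P Q where PQ: "gauss_jordan_single (transpose_mat A) = P * transpose_mat A"
    "P \<in> carrier_mat k k" "Q \<in> carrier_mat k k" "P * Q = 1\<^sub>m k" "Q * P = 1\<^sub>m k"
    using gauss_jordan_single(4)[OF At refl] by blast
  have "transpose_mat (A * transpose_mat P) = P * transpose_mat A"
    using transpose_mult[OF assms, of "transpose_mat P"] PQ by simp
  then have "col_echelon_form (A * transpose_mat P)"
    using gauss_jordan_single(3)[OF At refl] PQ(1) by (simp add: col_echelon_form_def)
  moreover have "transpose_mat P * transpose_mat Q = 1\<^sub>m k"
    unfolding transpose_mult[OF PQ(3,2), symmetric] PQ(5) by simp
  moreover have "transpose_mat Q * transpose_mat P = 1\<^sub>m k"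
    unfolding transpose_mult[OF PQ(2,3), symmetric] PQ(4) by simp
  moreover note PQ(2,3)
  ultimately show ?thesis using GL_matsI[of "transpose_mat P" k "transpose_mat Q"] by auto
qed

lemma tau:
  fixes A :: "'a::field mat"
  assumes "A \<in> rank_mats k n k"
  shows tau_in_GL_mats: "tau k A \<in> GL_mats k" and mult_tau: "A * tau k A \<in> echelon_mats n k"
proof -
  obtain T where T: "T \<in> GL_mats k" "col_echelon_form (A * T)"
    using ex_col_echelon_form[of A n k] assms unfolding rank_mats_def by blast
  then show "tau k A \<in> GL_mats k" "A * tau k A \<in> echelon_mats n k"
    using tau_eqI[OF assms T] rank_mats_mult_GL[OF assms T(1)] by (auto simp: echelon_mats_def)
qed

subsection \<open>Transfer to matrices\<close>

lemma word_mat_in_echelon_mats: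
  "R \<in> gr_words 0 (card (UNIV :: 'a set) ^ m) n \<Longrightarrow>
    (word_mat n m R :: 'a::{field,finite} mat) \<in> echelon_mats n m"
  by (simp add: echelon_mats_iff_pivots pivots_word_mat)

text \<open>The colour of a word is the packed function \<open>T\<close> to \<open>c (_ * T)\<close>
  on the finite group. That \<open>R * E\<close> is again echelon follows since composed words are
  restricted growth words; it will determine \<open>tau\<close> on the products.\<close>

lemma echelon_ramsey:
  fixes r :: nat
  shows "\<exists>n. \<forall>c :: 'a::{field,finite} mat \<Rightarrow> nat. (\<forall>A. c A < r) \<longrightarrow>
    (\<exists>R\<in>echelon_mats n m. (\<forall>E\<in>echelon_mats m k. R * E \<in> echelon_mats n k) \<and>
      (\<forall>T\<in>GL_mats k. \<forall>E\<in>echelon_mats m k. \<forall>E'\<in>echelon_mats m k. c (R * E * T) = c (R * E' * T)))"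
proof -
  let ?q = "card (UNIV :: 'a set)"
  have "0 < ?q ^ k" "0 < ?q ^ m" by (simp_all add: finite_UNIV_card_ge_0)
  then obtain K M where KM: "?q ^ k = Suc K" "?q ^ m = Suc M" by (metis gr0_conv_Suc)
  obtain s and enc :: "('a mat \<Rightarrow> nat) \<Rightarrow> nat" where
    enc: "\<forall>f. (\<forall>i. f i < r) \<longrightarrow> enc f < s \<and>
      (\<forall>g. (\<forall>i. g i < r) \<and> enc f = enc g \<longrightarrow> (\<forall>i\<in>GL_mats k. f i = g i))"
    using encode_family[OF finite_GL_mats[of k, where 'a='a], of r] by auto
  obtain n where n: "\<And>c :: nat list \<Rightarrow> nat. (\<forall>w. c w < s) \<Longrightarrow>
     \<exists>R\<in>gr_words 0 (?q ^ m) n. \<exists>\<gamma>. \<forall>E\<in>gr_words 0 (?q ^ k) (?q ^ m). c (map ((!) E) R) = \<gamma>"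
    using dual_ramsey[of s M K] unfolding KM by blast
  show ?thesis
  proof (intro exI[of _ n] allI impI)
    fix c :: "'a mat \<Rightarrow> nat" assume c: "\<forall>A. c A < r"
    obtain R \<gamma> where R: "R \<in> gr_words 0 (?q ^ m) n"
      and \<gamma>: "\<And>E. E \<in> gr_words 0 (?q ^ k) (?q ^ m) \<Longrightarrow>
        enc (\<lambda>T. c (word_mat n k (map ((!) E) R) * T)) = \<gamma>"
      using n[of "\<lambda>w. enc (\<lambda>T. c (word_mat n k w * T))"] enc c by auto
    let ?R = "word_mat n m R :: 'a mat"
    have table: "mat_table k m E \<in> gr_words 0 (?q ^ k) (?q ^ m)"
      "word_mat n k (map ((!) (mat_table k m E)) R) = ?R * E"
      if "E \<in> echelon_mats m k" for E :: "'a mat"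
      using that mat_table_in_gr_words word_mat_table[OF R]
      unfolding echelon_mats_iff_pivots by blast+
    show "\<exists>R\<in>echelon_mats n m. (\<forall>E\<in>echelon_mats m k. R * E \<in> echelon_mats n k) \<and>
      (\<forall>T\<in>GL_mats k. \<forall>E\<in>echelon_mats m k. \<forall>E'\<in>echelon_mats m k. c (R * E * T) = c (R * E' * T))"
    proof (intro bexI[of _ ?R] conjI ballI)
      show "?R \<in> echelon_mats n m"
        by (rule word_mat_in_echelon_mats[OF R])
    next
      fix E :: "'a mat" assume E: "E \<in> echelon_mats m k"
      have "map (sub 0 (mat_table k m E)) R \<in> gr_words 0 (?q ^ k) n"
        using gr_words_sub[OF R table(1)[OF E]] .
      moreover have "sub 0 (mat_table k m E) = (!) (mat_table k m E)" by (auto simp: sub_def)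
      ultimately have "map ((!) (mat_table k m E)) R \<in> gr_words 0 (?q ^ k) n" by simp
      from word_mat_in_echelon_mats[OF this] show "?R * E \<in> echelon_mats n k"
        unfolding table(2)[OF E] .
    next
      fix T E E' :: "'a mat"
      assume T: "T \<in> GL_mats k" and E: "E \<in> echelon_mats m k" "E' \<in> echelon_mats m k"
      have "enc (\<lambda>T. c (?R * E * T)) = enc (\<lambda>T. c (?R * E' * T))"
        using \<gamma>[OF table(1)[OF E(1)], unfolded table(2)[OF E(1)]]
          \<gamma>[OF table(1)[OF E(2)], unfolded table(2)[OF E(2)]] by (simp only:)
      then show "c (?R * E * T) = c (?R * E' * T)"
        using enc[rule_format, of "\<lambda>T. c (?R * E * T)", THEN conjunct2, rule_format,
            OF _ conjI, of "\<lambda>T. c (?R * E' * T)" T] c T by simp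
    qed
  qed
qed

text \<open>With \<open>E = A * tau k A\<close> and \<open>S\<close> inverse to
  \<open>tau k A\<close>, one has \<open>R * A = (R * E) * S\<close>. As \<open>R * E\<close> is
  echelon, \<open>tau k (R * A) = tau k A\<close>, and the colour depends on \<open>S\<close>
  alone.\<close>

lemma tau_factor_of_colouring:
  fixes k m r :: nat
  assumes r: "0 < r"
  shows "\<exists>n::nat. \<forall>c :: ('a::{field,finite}) mat \<Rightarrow> nat.
           (\<forall>A \<in> rank_mats k n k. c A < r) \<longrightarrow>
           (\<exists>R \<in> echelon_mats n m. \<exists>ch :: 'a mat \<Rightarrow> nat.
              (\<forall>T \<in> GL_mats k. ch T < r) \<and>
              (\<forall>A \<in> rank_mats k m k. c (R * A) = ch (tau k (R * A))))"
proof -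
  obtain n where n: "\<And>c :: 'a mat \<Rightarrow> nat. (\<forall>A. c A < r) \<Longrightarrow>
    (\<exists>R\<in>echelon_mats n m. (\<forall>E\<in>echelon_mats m k. R * E \<in> echelon_mats n k) \<and>
      (\<forall>T\<in>GL_mats k. \<forall>E\<in>echelon_mats m k. \<forall>E'\<in>echelon_mats m k. c (R * E * T) = c (R * E' * T)))"
    using echelon_ramsey[where 'a='a] by blast
  show ?thesis
  proof (intro exI[of _ n] allI impI)
    fix c :: "'a mat \<Rightarrow> nat" assume c: "\<forall>A \<in> rank_mats k n k. c A < r"
    \<comment> \<open>The colouring is bounded on matrices of rank \<open>k\<close> only; the
      default \<open>0\<close> is a legal colour because \<open>0 < r\<close>.\<close>
    define c' where "c' A = (if A \<in> rank_mats k n k then c A else 0)" for A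
    have "\<forall>A. c' A < r" using c r by (simp add: c'_def)
    from n[OF this] obtain R :: "'a mat" where R: "R \<in> echelon_mats n m"
      and RE: "\<And>E. E \<in> echelon_mats m k \<Longrightarrow> R * E \<in> echelon_mats n k"
      and RT: "\<And>T E E'. \<lbrakk>T \<in> GL_mats k; E \<in> echelon_mats m k; E' \<in> echelon_mats m k\<rbrakk>
          \<Longrightarrow> c' (R * E * T) = c' (R * E' * T)" by blast
    have Rcar: "R \<in> carrier_mat n m" using R by (simp add: echelon_mats_def rank_mats_def)
    have main: "R * A \<in> rank_mats k n k \<and> tau k (R * A) = tau k A \<and>
        R * (A * tau k A) * S = R * A"
      if A: "A \<in> rank_mats k m k" and S: "S \<in> GL_mats k" "tau k A * S = 1\<^sub>m k" for A S
    proof -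
      let ?T = "tau k A"
      have car: "A \<in> carrier_mat m k" "?T \<in> carrier_mat k k" "S \<in> carrier_mat k k"
        using A S tau_in_GL_mats[OF A] by (auto simp: rank_mats_def GL_mats_def)
      have assoc: "R * (A * ?T) = R * A * ?T"
        using Rcar car by (simp add: assoc_mult_mat[of _ n m _ k _ k])
      have "R * (A * ?T) * S = R * A * (?T * S)"
        unfolding assoc using Rcar car by (intro assoc_mult_mat[of _ n k _ k _ k]) auto
      then have eq: "R * (A * ?T) * S = R * A" using S(2) Rcar car by simp
      have ech: "R * (A * ?T) \<in> echelon_mats n k" using RE[OF mult_tau[OF A]] .
      then have "R * (A * ?T) * S \<in> rank_mats k n k"
        by (intro rank_mats_mult_GL[OF _ S(1)]) (simp add: echelon_mats_def)
      then have mem: "R * A \<in> rank_mats k n k" unfolding eq .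
      moreover have "tau k (R * A) = ?T"
        using ech unfolding assoc
        by (intro tau_eqI[OF mem tau_in_GL_mats[OF A]]) (simp add: echelon_mats_def)
      ultimately show ?thesis using eq by simp
    qed
    have const: "c (R * A) = c (R * A')"
      if A: "A \<in> rank_mats k m k" "A' \<in> rank_mats k m k" and eq: "tau k A' = tau k A" for A A'
    proof -
      obtain S where S: "S \<in> GL_mats k" "tau k A * S = 1\<^sub>m k"
        using GL_matsD[OF tau_in_GL_mats[OF A(1)]] by metis
      have "c' (R * (A * tau k A) * S) = c' (R * (A' * tau k A') * S)"
        by (rule RT[OF S(1) mult_tau[OF A(1)] mult_tau[OF A(2)]])
      moreover have "R * (A * tau k A) * S = R * A" "R * (A' * tau k A') * S = R * A'"
        using main[OF A(1) S] main[OF A(2) S(1)] S(2) eq by simp_all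
      ultimately have "c' (R * A) = c' (R * A')" by (simp only:)
      moreover have "R * A \<in> rank_mats k n k" "R * A' \<in> rank_mats k n k"
        using main[OF A(1) S] main[OF A(2) S(1)] S(2) eq by simp_all
      ultimately show ?thesis by (simp add: c'_def)
    qed
    \<comment> \<open>If \<open>T\<close> is not a value of \<open>tau\<close>, then
      \<open>rep T\<close> is arbitrary; using \<open>c'\<close> keeps \<open>ch T\<close> below
      \<open>r\<close> even then.\<close>
    define rep where "rep T = (SOME A. A \<in> rank_mats k m k \<and> tau k A = T)" for T :: "'a mat"
    define ch where "ch T = c' (R * rep T)" for T :: "'a mat"
    have "c (R * A) = ch (tau k (R * A))" if A: "A \<in> rank_mats k m k" for A
    proof -
      have tau_RA: "R * B \<in> rank_mats k n k \<and> tau k (R * B) = tau k B" if "B \<in> rank_mats k m k" for B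
        using main[OF that] GL_matsD[OF tau_in_GL_mats[OF that]] by metis
      have rep: "rep (tau k A) \<in> rank_mats k m k \<and> tau k (rep (tau k A)) = tau k A"
        unfolding rep_def by (rule someI[of _ A]) (use A in simp)
      then show ?thesis
        using const[of A "rep (tau k A)"] tau_RA[of "rep (tau k A)"] tau_RA[OF A] A
        by (simp add: ch_def c'_def)
    qed
    moreover have "\<forall>T\<in>GL_mats k. ch T < r" using \<open>\<forall>A. c' A < r\<close> by (simp add: ch_def)
    ultimately show "\<exists>R \<in> echelon_mats n m. \<exists>ch :: 'a mat \<Rightarrow> nat.
              (\<forall>T \<in> GL_mats k. ch T < r) \<and>
              (\<forall>A \<in> rank_mats k m k. c (R * A) = ch (tau k (R * A)))"
      using R by blast
  qed
qed

theorem theorem5p4: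
  fixes k m r :: nat
  shows "\<exists>n::nat. \<forall>c :: ('a::{field,finite}) mat \<Rightarrow> nat.
           (\<forall>A \<in> rank_mats k n k. c A < r) \<longrightarrow>
           (\<exists>R \<in> echelon_mats n m. \<exists>ch :: 'a mat \<Rightarrow> nat.
              (\<forall>T \<in> GL_mats k. ch T < r) \<and>
              (\<forall>A \<in> rank_mats k m k. c (R * A) = ch (tau k (R * A))))"
proof (cases "r = 0")
  case True
  \<comment> \<open>Without colours it suffices that some matrix needs one. The one-colour case with
    \<open>m = k\<close> supplies an \<open>n\<close> for which matrices of rank \<open>k\<close>
    exist, so no admissible \<open>c\<close> is left.\<close>
  obtain n where "echelon_mats n k \<noteq> ({} :: 'a mat set)"
    using echelon_ramsey[where 'a='a, of 1 k k] by (auto dest!: spec[of _ "\<lambda>_. 0"])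
  then have "rank_mats k n k \<noteq> ({} :: 'a mat set)" by (auto simp: echelon_mats_def)
  then show ?thesis using True by auto
next
  case False
  then show ?thesis using tau_factor_of_colouring by blast
qed

end
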